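(* Let $Q$ be a convex quadrilateral in the $xy$ plane, let $\operatorname{int}(Q)$ denote the interior of $Q$, and let $\partial(Q)$ denote the boundary of $Q$. Let $D_1$ and $D_2$ denote the diagonals of $Q$ and let $P$ denote their point of intersection. Let $P_0=(x_0,y_0)$ be a point in $\bar{Q}=\operatorname{int}(Q)\cup\partial(Q)$. (i) If $P_0\in\operatorname{int}(Q)$ and $P_0\notin D_1\cup D_2$, then there are exactly two ellipses inscribed in $Q$ which pass through $P_0$. (ii) If $P_0\in\operatorname{int}(Q)$ and $P_0\in D_1\cup D_2$, but $P_0\neq P$, then there is exactly one ellipse inscribed in $Q$ which passes through $P_0$. (iii) There is no ellipse inscribed in $Q$ which passes through $P$. (iv) If $P_0\in\partial(Q)$, but $P_0$ is not one of the vertices of $Q$, then there is exactly one ellipse inscribed in $Q$ which passes through $P_0$ (and is thus tangent to $Q$ at one of its sides).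
   Context: An ellipse (a non-degenerate one; circles are allowed), regarded as a curve, is said to be inscribed in a convex quadrilateral $Q$ if it lies in $\bar{Q}$ and is tangent to each of the four sides of $Q$. The diagonals $D_1,D_2$ are the line segments joining opposite vertices. *)

theory Defs
  imports "HOL-Analysis.Analysis"
begin

text \<open>
  An ellipse as a curve, i.e. as a set of points: \<open>c\<close> is the centre, the orthonormal vectors
  \<open>u\<close>, \<open>v\<close> span the axes and \<open>a\<close>, \<open>b\<close> are the semi-axes. Circles are the case \<open>a = b\<close>.
\<close>

definition ellipse :: "(real^2) set \<Rightarrow> bool" where
  "ellipse E \<longleftrightarrow> (\<exists>c u v a b. norm u = 1 \<and> norm v = 1 \<and> u \<bullet> v = 0 \<and> a > 0 \<and> b > 0 \<and>
     E = {p. (((p - c) \<bullet> u) / a)\<^sup>2 + (((p - c) \<bullet> v) / b)\<^sup>2 = 1})"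

text \<open>
  Tangent vectors in the sense of differential geometry: velocities of curves running inside the
  set. Requiring this of all \<open>t\<close> rather than of \<open>t\<close> near \<open>0\<close> is no restriction, since
  \<open>\<gamma>\<close> is not assumed to be regular away from \<open>0\<close>.
\<close>

definition tangent_vector :: "(real^2) set \<Rightarrow> real^2 \<Rightarrow> real^2 \<Rightarrow> bool" where
  "tangent_vector E p w \<longleftrightarrow>
     (\<exists>\<gamma> :: real \<Rightarrow> real^2. (\<forall>t. \<gamma> t \<in> E) \<and> \<gamma> 0 = p \<and> (\<gamma> has_vector_derivative w) (at 0))"

text \<open>
  Tangency of a curve to the side with (distinct) end points \<open>X\<close>, \<open>Y\<close>; the point of contact has
  to lie on the segment, not merely on the line through it.
\<close>

definition tangent_to_side_at :: "(real^2) set \<Rightarrow> real^2 \<Rightarrow> real^2 \<Rightarrow> real^2 \<Rightarrow> bool" where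
  "tangent_to_side_at E X Y p \<longleftrightarrow> p \<in> E \<and> p \<in> closed_segment X Y \<and> tangent_vector E p (Y - X)"

definition tangent_to_side :: "(real^2) set \<Rightarrow> real^2 \<Rightarrow> real^2 \<Rightarrow> bool" where
  "tangent_to_side E X Y \<longleftrightarrow> (\<exists>p. tangent_to_side_at E X Y p)"

text \<open>
  The vertices are listed in cyclic order. That the four sides are edges of the convex hull makes
  each of the four distinct vertices an extreme point, so no three of them are collinear.
\<close>

definition convex_quadrilateral :: "real^2 \<Rightarrow> real^2 \<Rightarrow> real^2 \<Rightarrow> real^2 \<Rightarrow> bool" where
  "convex_quadrilateral A B C D \<longleftrightarrow> distinct [A, B, C, D] \<and>
     closed_segment A B edge_of convex hull {A, B, C, D} \<and>
     closed_segment B C edge_of convex hull {A, B, C, D} \<and>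
     closed_segment C D edge_of convex hull {A, B, C, D} \<and>
     closed_segment D A edge_of convex hull {A, B, C, D}"

definition inscribed :: "(real^2) set \<Rightarrow> real^2 \<Rightarrow> real^2 \<Rightarrow> real^2 \<Rightarrow> real^2 \<Rightarrow> bool" where
  "inscribed E A B C D \<longleftrightarrow> ellipse E \<and> E \<subseteq> convex hull {A, B, C, D} \<and>
     tangent_to_side E A B \<and> tangent_to_side E B C \<and>
     tangent_to_side E C D \<and> tangent_to_side E D A"

end

theory Submission
  imports Defs
begin

text \<open>
  In affine coordinates along the diagonals, with origin \<open>P\<close>, unit points \<open>A\<close> and \<open>B\<close>, and
  \<open>C = (- 1 / g, 0)\<close>, \<open>D = (0, - 1 / d)\<close>, the sides lie on the four lines \<open>u x + v y = 1\<close> with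
  \<open>u \<in> {1, -g}\<close> and \<open>v \<in> {1, -d}\<close>. In the dual plane these are the corners of a rectangle
  with sides parallel to the axes. The dual conics through them form the pencil
  \<open>l (u - 1) (u + g) + m (v - 1) (v + d) = 0\<close>, and those with \<open>l, m > 0\<close> are exactly the duals of
  the inscribed ellipses: an ellipse inside the quadrilateral is tangent to a side as soon as it
  meets that side (\<open>supported_ellipse_tangent_vector\<close>), and strict Cauchy-Schwarz gives the signs
  (\<open>dual_conic_through_rectangle\<close>). So the inscribed ellipses form a family with one
  parameter \<open>t > 0\<close> (\<open>inscribed_conic\<close>, \<open>inscribed_imp_conic\<close>, \<open>inj_on_conic\<close>).

  Let \<open>h = (1 + g) / 2\<close>, \<open>k = (1 + d) / 2\<close> be the half widths of the rectangle,
  \<open>L = 1 - x (1 - g) / 2 - y (1 - d) / 2\<close> and \<open>S = h \<bar>x\<bar> + k \<bar>y\<bar>\<close>. A point \<open>(x, y)\<close> lies on an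
  ellipse if its polar line touches the dual conic. For the pencil this becomes
  \<open>L\<^sup>2 = h\<^sup>2 x\<^sup>2 + k\<^sup>2 y\<^sup>2 + h k (t x\<^sup>2 + y\<^sup>2 / t)\<close>, or
  \<open>t x\<^sup>2 + y\<^sup>2 / t = 2 \<bar>x\<bar> \<bar>y\<bar> + (L\<^sup>2 - S\<^sup>2) / (h k)\<close>. The quadrilateral is \<open>S \<le> L\<close> and its
  interior is \<open>S < L\<close>, so it remains to count the positive solutions \<open>t\<close>. The left-hand side has
  the minimum \<open>2 \<bar>x\<bar> \<bar>y\<bar>\<close> when \<open>x, y \<noteq> 0\<close>. Hence there are two solutions in the interior off the
  diagonals and one, \<open>t = \<bar>y\<bar> / \<bar>x\<bar>\<close>, on the boundary. On a diagonal, \<open>x = 0\<close> or \<open>y = 0\<close>, the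
  equation is linear in \<open>1 / t\<close> or in \<open>t\<close> and has one positive solution; at \<open>P\<close> it reads \<open>0 = 1 / (h k)\<close>.
\<close>

section \<open>Ellipses and their supporting lines\<close>

definition det2 :: "real^2 \<Rightarrow> real^2 \<Rightarrow> real" where
  "det2 p q = p$1 * q$2 - p$2 * q$1"

lemma det2_expand:
  assumes "det2 p q \<noteq> 0"
  obtains s r where "z = s *\<^sub>R p + r *\<^sub>R q"
proof
  have "det2 p q *\<^sub>R z = det2 z q *\<^sub>R p + det2 p z *\<^sub>R q"
    by (simp add: vec_eq_iff forall_2 det2_def algebra_simps)
  then have "z = (1 / det2 p q) *\<^sub>R (det2 z q *\<^sub>R p + det2 p z *\<^sub>R q)"
    using assms by (metis divide_self_if scaleR_one scaleR_scaleR times_divide_eq_left mult_1)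
  then show "z = (det2 z q / det2 p q) *\<^sub>R p + (det2 p z / det2 p q) *\<^sub>R q"
    by (simp add: scaleR_right_distrib)
qed

lemma det2_inner_eq_0:
  assumes "det2 p q \<noteq> 0" and "n \<bullet> p = 0" and "n \<bullet> q = 0"
  shows "n = 0"
proof -
  obtain s r where "n = s *\<^sub>R p + r *\<^sub>R q"
    using det2_expand[OF assms(1)] .
  then have "n \<bullet> n = 0"
    using assms by (simp add: inner_add_right)
  then show ?thesis by simp
qed

lemma det2_squared: "(det2 p q)\<^sup>2 = (p \<bullet> p) * (q \<bullet> q) - (p \<bullet> q)\<^sup>2"
  by (simp add: det2_def inner_vec_def sum_2 power2_eq_square algebra_simps)

lemma det2_orthogonal:
  assumes "p \<bullet> q = 0" "p \<noteq> 0" "q \<noteq> 0"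
  shows "det2 p q \<noteq> 0"
  using det2_squared[of p q] assms by auto

lemma orthogonal_2_parallel:
  assumes "n \<noteq> 0" "n \<bullet> w = 0" "n \<bullet> v = 0" "v \<noteq> (0::real^2)"
  obtains \<kappa> where "w = \<kappa> *\<^sub>R v"
proof -
  obtain s r where w: "w = s *\<^sub>R n + r *\<^sub>R v"
    using det2_expand det2_orthogonal assms by metis
  then have "s * (n \<bullet> n) = 0"
    using assms by (simp add: inner_add_right)
  then show ?thesis using w assms that by simp
qed

definition circle_image :: "real^2 \<Rightarrow> real^2 \<Rightarrow> real^2 \<Rightarrow> (real^2) set" where
  "circle_image c p q = {c + s *\<^sub>R p + r *\<^sub>R q | s r. s\<^sup>2 + r\<^sup>2 = 1}"

lemma circle_image_iff:
  assumes d: "det2 p q \<noteq> 0"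
  shows "c + s *\<^sub>R p + r *\<^sub>R q \<in> circle_image c p q \<longleftrightarrow> s\<^sup>2 + r\<^sup>2 = 1"
proof
  assume "c + s *\<^sub>R p + r *\<^sub>R q \<in> circle_image c p q"
  then obtain s' r' where sr: "s'\<^sup>2 + r'\<^sup>2 = 1"
    and eq: "s *\<^sub>R p + r *\<^sub>R q = s' *\<^sub>R p + r' *\<^sub>R q"
    unfolding circle_image_def by (auto simp: add.assoc)
  have "s * det2 p q = det2 (s *\<^sub>R p + r *\<^sub>R q) q" "r * det2 p q = det2 p (s *\<^sub>R p + r *\<^sub>R q)"
    for s r by (simp_all add: det2_def algebra_simps)
  then have "s = s'" "r = r'" using eq d by (metis mult_right_cancel)+
  with sr show "s\<^sup>2 + r\<^sup>2 = 1" by simp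
qed (auto simp: circle_image_def)

text \<open>
  An affine image of the unit circle is easier to handle than the implicit equation: the support
  function of such a curve can be read off from its two defining vectors.
\<close>

lemma ellipse_circle_image:
  assumes "ellipse E"
  obtains c p q where "det2 p q \<noteq> 0" "E = circle_image c p q"
proof -
  obtain c u v a b where nu: "norm u = 1" "norm v = 1" and uv: "u \<bullet> v = 0" and ab: "a > 0" "b > 0"
    and E: "E = {p. (((p - c) \<bullet> u) / a)\<^sup>2 + (((p - c) \<bullet> v) / b)\<^sup>2 = 1}"
    using assms unfolding ellipse_def by blast
  have uu: "u \<bullet> u = 1" "v \<bullet> v = 1" using nu by (simp_all add: dot_square_norm)
  have vu: "v \<bullet> u = 0" using uv by (simp add: inner_commute)
  have d: "det2 u v \<noteq> 0" using uv nu by (intro det2_orthogonal) auto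
  have "det2 (a *\<^sub>R u) (b *\<^sub>R v) = a * b * det2 u v"
    by (simp add: det2_def algebra_simps)
  then have d': "det2 (a *\<^sub>R u) (b *\<^sub>R v) \<noteq> 0" using d ab by simp
  have "E = circle_image c (a *\<^sub>R u) (b *\<^sub>R v)"
  proof (intro set_eqI iffI)
    fix z assume z: "z \<in> E"
    obtain s r where sr: "z - c = s *\<^sub>R (a *\<^sub>R u) + r *\<^sub>R (b *\<^sub>R v)"
      using det2_expand[OF d'] .
    then have "s\<^sup>2 + r\<^sup>2 = 1"
      using z ab unfolding E by (simp add: inner_add_left uu uv vu)
    moreover have "z = c + s *\<^sub>R (a *\<^sub>R u) + r *\<^sub>R (b *\<^sub>R v)"
      using sr by (simp add: algebra_simps)
    ultimately show "z \<in> circle_image c (a *\<^sub>R u) (b *\<^sub>R v)"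
      unfolding circle_image_def by blast
  next
    fix z assume "z \<in> circle_image c (a *\<^sub>R u) (b *\<^sub>R v)"
    then show "z \<in> E"
      using ab unfolding circle_image_def E by (auto simp: inner_add_left uu uv vu)
  qed
  then show ?thesis using that d' by blast
qed

text \<open>
  The linear forms may be rotated into each other without changing the sum of their squares. The
  inner product of the rotated pair changes sign after a quarter turn, so it vanishes for some angle;
  there the two forms point along the axes of the ellipse. This is the diagonalisation of a definite
  binary quadratic form by the intermediate value theorem.
\<close>

lemma ellipse_sum_of_squares:
  assumes d: "det2 r s \<noteq> 0"
  shows "ellipse {z. ((z - c) \<bullet> r)\<^sup>2 + ((z - c) \<bullet> s)\<^sup>2 = 1}"
proof -
  let ?R = "\<lambda>\<phi>. cos \<phi> *\<^sub>R r + sin \<phi> *\<^sub>R s"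
  let ?S = "\<lambda>\<phi>. cos \<phi> *\<^sub>R s - sin \<phi> *\<^sub>R r"
  let ?f = "\<lambda>\<phi>. ?R \<phi> \<bullet> ?S \<phi>"
  have cont: "continuous_on {0..pi/2} ?f"
    by (intro continuous_intros)
  have f0: "?f 0 = r \<bullet> s" and f1: "?f (pi/2) = - (r \<bullet> s)"
    by (simp_all add: inner_commute)
  obtain \<phi> where orth: "?f \<phi> = 0"
  proof (cases "r \<bullet> s \<le> 0")
    case True
    then show ?thesis
      using IVT'[of ?f 0 0 "pi/2", OF _ _ _ cont] f0 f1 that by auto
  next
    case False
    then show ?thesis
      using IVT2'[of ?f "pi/2" 0 0, OF _ _ _ cont] f0 f1 that by auto
  qed
  define a where "a = cos \<phi>"
  define b where "b = sin \<phi>"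
  have ab: "a\<^sup>2 + b\<^sup>2 = 1" by (simp add: a_def b_def)
  define R where "R = a *\<^sub>R r + b *\<^sub>R s"
  define S where "S = a *\<^sub>R s - b *\<^sub>R r"
  have "det2 R S = (a\<^sup>2 + b\<^sup>2) * det2 r s"
    unfolding R_def S_def det2_def by (simp add: algebra_simps power2_eq_square)
  then have dRS: "det2 R S \<noteq> 0" using d ab by simp
  then have nz: "R \<noteq> 0" "S \<noteq> 0" by (auto simp: det2_def)
  have sq: "(z \<bullet> r)\<^sup>2 + (z \<bullet> s)\<^sup>2 = (z \<bullet> R)\<^sup>2 + (z \<bullet> S)\<^sup>2" for z
  proof -
    have "(z \<bullet> R)\<^sup>2 + (z \<bullet> S)\<^sup>2 = (a\<^sup>2 + b\<^sup>2) * ((z \<bullet> r)\<^sup>2 + (z \<bullet> s)\<^sup>2)"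
      unfolding R_def S_def
      by (simp add: inner_add_right inner_diff_right power2_eq_square algebra_simps)
    then show ?thesis using ab by simp
  qed
  show ?thesis
    unfolding ellipse_def
  proof (intro exI conjI)
    show "norm (R /\<^sub>R norm R) = 1" "norm (S /\<^sub>R norm S) = 1" using nz by simp_all
    show "(R /\<^sub>R norm R) \<bullet> (S /\<^sub>R norm S) = 0" using orth by (simp add: R_def S_def a_def b_def)
    show "1 / norm R > 0" "1 / norm S > 0" using nz by simp_all
    show "{z. ((z - c) \<bullet> r)\<^sup>2 + ((z - c) \<bullet> s)\<^sup>2 = 1} =
      {p. ((p - c) \<bullet> (R /\<^sub>R norm R) / (1 / norm R))\<^sup>2 + ((p - c) \<bullet> (S /\<^sub>R norm S) / (1 / norm S))\<^sup>2 = 1}"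
      using nz by (simp add: sq inverse_eq_divide)
  qed
qed

text \<open>
  On the curve \<open>c + s p + r q\<close> the form \<open>n\<close> is at most
  \<open>n \<bullet> c + sqrt ((n \<bullet> p)\<^sup>2 + (n \<bullet> q)\<^sup>2)\<close> by Cauchy-Schwarz, and this value is attained. So a
  supporting line that meets the curve determines the square root, and at the contact point there is
  equality in Cauchy-Schwarz, which says that the velocity \<open>s q - r p\<close> runs along the line.
\<close>

lemma circle_image_support:
  assumes d: "det2 p q \<noteq> 0" and n: "n \<noteq> 0"
    and le: "\<And>z. z \<in> circle_image c p q \<Longrightarrow> n \<bullet> z \<le> \<beta>"
    and sr: "s\<^sup>2 + r\<^sup>2 = 1" and eq: "n \<bullet> (c + s *\<^sub>R p + r *\<^sub>R q) = \<beta>"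
  shows "(\<beta> - n \<bullet> c)\<^sup>2 = (n \<bullet> p)\<^sup>2 + (n \<bullet> q)\<^sup>2" and "n \<bullet> c < \<beta>"
    and "n \<bullet> (s *\<^sub>R q - r *\<^sub>R p) = 0"
proof -
  define R where "R = sqrt ((n \<bullet> p)\<^sup>2 + (n \<bullet> q)\<^sup>2)"
  have pq: "(n \<bullet> p)\<^sup>2 + (n \<bullet> q)\<^sup>2 > 0"
    using det2_inner_eq_0[OF d] n by (auto simp: sum_power2_gt_zero_iff)
  then have R: "R > 0" and R2: "R\<^sup>2 = (n \<bullet> p)\<^sup>2 + (n \<bullet> q)\<^sup>2" by (simp_all add: R_def)
  have "((n \<bullet> p) / R)\<^sup>2 + ((n \<bullet> q) / R)\<^sup>2 = 1"
    using R by (simp add: power_divide flip: add_divide_distrib R2)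
  then have "c + ((n \<bullet> p) / R) *\<^sub>R p + ((n \<bullet> q) / R) *\<^sub>R q \<in> circle_image c p q"
    unfolding circle_image_def by blast
  from le[OF this] have "n \<bullet> c + ((n \<bullet> p)\<^sup>2 + (n \<bullet> q)\<^sup>2) / R \<le> \<beta>"
    by (simp add: inner_add_right power2_eq_square add_divide_distrib)
  moreover have "((n \<bullet> p)\<^sup>2 + (n \<bullet> q)\<^sup>2) / R = R"
    unfolding R2[symmetric] using R by (simp add: power2_eq_square)
  ultimately have ge: "n \<bullet> c + R \<le> \<beta>" by simp
  have e: "\<beta> - n \<bullet> c = s * (n \<bullet> p) + r * (n \<bullet> q)"
    using eq by (simp add: inner_add_right)
  (* s^2 + r^2 = 1 turns Lagrange's identity into a defect formula for Cauchy-Schwarz. *)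
  have lagrange: "(\<beta> - n \<bullet> c)\<^sup>2 + (n \<bullet> (s *\<^sub>R q - r *\<^sub>R p))\<^sup>2 = R\<^sup>2"
  proof -
    have "(\<beta> - n \<bullet> c)\<^sup>2 + (n \<bullet> (s *\<^sub>R q - r *\<^sub>R p))\<^sup>2 = (s\<^sup>2 + r\<^sup>2) * ((n \<bullet> p)\<^sup>2 + (n \<bullet> q)\<^sup>2)"
      unfolding e by (simp add: inner_diff_right power2_eq_square algebra_simps)
    then show ?thesis using sr R2 by simp
  qed
  have "R\<^sup>2 \<le> (\<beta> - n \<bullet> c)\<^sup>2" using ge R by (intro power_mono) auto
  moreover have "(n \<bullet> (s *\<^sub>R q - r *\<^sub>R p))\<^sup>2 \<ge> 0" by simp
  ultimately have "(\<beta> - n \<bullet> c)\<^sup>2 = R\<^sup>2" "(n \<bullet> (s *\<^sub>R q - r *\<^sub>R p))\<^sup>2 = 0"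
    using lagrange by linarith+
  then show "(\<beta> - n \<bullet> c)\<^sup>2 = (n \<bullet> p)\<^sup>2 + (n \<bullet> q)\<^sup>2" "n \<bullet> (s *\<^sub>R q - r *\<^sub>R p) = 0"
    using R2 by simp_all
  show "n \<bullet> c < \<beta>" using ge R by simp
qed

text \<open>
  Tangency is automatic as soon as an ellipse lies on one side of a line and meets it: the rotation of
  the parametrising circle moves along the line at the contact point, and adjusting its speed gives
  every vector of the line.
\<close>

lemma supported_ellipse_tangent_vector:
  assumes E: "ellipse E" and n: "n \<noteq> 0" and le: "\<And>z. z \<in> E \<Longrightarrow> n \<bullet> z \<le> \<beta>"
    and z0: "z0 \<in> E" "n \<bullet> z0 = \<beta>" and w: "n \<bullet> w = 0"
  shows "tangent_vector E z0 w"
proof -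
  obtain c p q where d: "det2 p q \<noteq> 0" and Eq: "E = circle_image c p q"
    using ellipse_circle_image[OF E] .
  obtain s r where sr: "s\<^sup>2 + r\<^sup>2 = 1" and z0': "z0 = c + s *\<^sub>R p + r *\<^sub>R q"
    using z0 unfolding Eq circle_image_def by blast
  let ?v = "s *\<^sub>R q - r *\<^sub>R p"
  have nv: "n \<bullet> ?v = 0"
    using circle_image_support(3)[OF d n _ sr, of c \<beta>] le z0 z0' Eq by blast
  have pv: "det2 p ?v = s * det2 p q" and qv: "det2 q ?v = r * det2 p q"
    by (simp_all add: det2_def algebra_simps)
  have "?v \<noteq> 0"
  proof
    assume "?v = 0"
    then have "s * det2 p q = 0" "r * det2 p q = 0"
      unfolding pv[symmetric] qv[symmetric] by (simp_all add: det2_def)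
    then show False using d sr by simp
  qed
  with n w nv obtain \<kappa> where \<kappa>: "w = \<kappa> *\<^sub>R ?v"
    using orthogonal_2_parallel by blast
  define \<gamma> where "\<gamma> t = c + (s * cos (\<kappa> * t) - r * sin (\<kappa> * t)) *\<^sub>R p
      + (r * cos (\<kappa> * t) + s * sin (\<kappa> * t)) *\<^sub>R q" for t
  show ?thesis
    unfolding tangent_vector_def
  proof (intro exI[of _ \<gamma>] conjI allI)
    fix t
    have "(s * a - r * b)\<^sup>2 + (r * a + s * b)\<^sup>2 = (s\<^sup>2 + r\<^sup>2) * (a\<^sup>2 + b\<^sup>2)" for a b :: real
      by (simp add: power2_eq_square algebra_simps)
    from this[of "cos (\<kappa> * t)" "sin (\<kappa> * t)"] show "\<gamma> t \<in> E"
      using sr unfolding Eq circle_image_def \<gamma>_def by auto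
  next
    show "\<gamma> 0 = z0" by (simp add: \<gamma>_def z0')
    show "(\<gamma> has_vector_derivative w) (at 0)"
      unfolding \<gamma>_def[abs_def] \<kappa>
      by (auto intro!: derivative_eq_intros simp: algebra_simps)
  qed
qed

lemma supported_ellipse_tangent_to_side_at:
  assumes "ellipse E" and "n \<noteq> 0" and "\<And>z. z \<in> E \<Longrightarrow> n \<bullet> z \<le> \<beta>"
    and X: "n \<bullet> X = \<beta>" and Y: "n \<bullet> Y = \<beta>" and z: "z \<in> E" "z \<in> closed_segment X Y"
  shows "tangent_to_side_at E X Y z"
proof -
  obtain u where "z = (1 - u) *\<^sub>R X + u *\<^sub>R Y"
    using z(2) by (auto simp: closed_segment_def)
  then have "n \<bullet> z = (1 - u) * \<beta> + u * \<beta>" using X Y by (simp add: inner_add_right)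
  then have "n \<bullet> z = \<beta>" by (simp add: algebra_simps)
  moreover have "n \<bullet> (Y - X) = 0" using X Y by (simp add: inner_diff_right)
  ultimately show ?thesis
    using supported_ellipse_tangent_vector[OF assms(1-3)] z
    unfolding tangent_to_side_at_def by blast
qed

section \<open>The pencil of dual conics through a rectangle\<close>

text \<open>
  An ellipse with centre \<open>c\<close> and defining vectors \<open>(X1, Y1)\<close>, \<open>(X2, Y2)\<close> touches the line
  \<open>u x + v y = 1\<close> if and only if a quadratic polynomial in \<open>(u, v)\<close> vanishes, the equation of the dual
  conic. If it vanishes at the four corners of the rectangle \<open>{1, -g} \<times> {1, -d}\<close>, its mixed term is
  zero and it is a combination \<open>- l (u - 1) (u + g) - m (v - 1) (v + d)\<close>, which gives all the
  equations below by comparing coefficients. The signs are the delicate point. Strict Cauchy-Schwarz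
  for the two coordinate rows becomes \<open>l m N > 0\<close>, and \<open>N\<close>, the mean over the four lines of
  \<open>1 - (u c1 + v c2)\<close>, is positive because the centre lies strictly inside. So \<open>l\<close> and \<open>m\<close> have
  the same sign, which is positive by \<open>l g + m d = 1\<close>.
\<close>

lemma dual_conic_through_rectangle:
  fixes c1 c2 X1 X2 Y1 Y2 g d :: real
  assumes g: "g > 0" and d: "d > 0" and det: "X1 * Y2 - X2 * Y1 \<noteq> 0"
    and tangent: "\<And>u v. u \<in> {1, -g} \<Longrightarrow> v \<in> {1, -d} \<Longrightarrow>
      (1 - (u * c1 + v * c2))\<^sup>2 = (u * X1 + v * Y1)\<^sup>2 + (u * X2 + v * Y2)\<^sup>2"
    and inside: "\<And>u v. u \<in> {1, -g} \<Longrightarrow> v \<in> {1, -d} \<Longrightarrow> u * c1 + v * c2 < 1"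
  obtains l m where "l > 0" "m > 0" "l * g + m * d = 1"
    "c1 = - (l * (1 - g) / 2)" "c2 = - (m * (1 - d) / 2)"
    "X1\<^sup>2 + X2\<^sup>2 = c1\<^sup>2 + l" "Y1\<^sup>2 + Y2\<^sup>2 = c2\<^sup>2 + m" "X1 * Y1 + X2 * Y2 = c1 * c2"
proof -
  define V where "V = X1\<^sup>2 + X2\<^sup>2"
  define W where "W = Y1\<^sup>2 + Y2\<^sup>2"
  define Z where "Z = X1 * Y1 + X2 * Y2"
  define l where "l = V - c1\<^sup>2"
  define m where "m = W - c2\<^sup>2"
  define z where "z = c1 * c2 - Z"
  have q: "1 - 2 * c1 * u - 2 * c2 * v - l * u\<^sup>2 - m * v\<^sup>2 + 2 * z * (u * v) = 0"
    if "u \<in> {1, -g}" "v \<in> {1, -d}" for u v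
    using tangent[OF that] unfolding l_def m_def z_def V_def W_def Z_def
    by (simp add: power2_eq_square algebra_simps)
  have q1: "1 - 2 * c1 - 2 * c2 - l - m + 2 * z = 0" using q[of 1 1] by simp
  have q2: "1 + 2 * c1 * g - 2 * c2 - l * g\<^sup>2 - m - 2 * z * g = 0" using q[of "-g" 1] by simp
  have q3: "1 - 2 * c1 + 2 * c2 * d - l - m * d\<^sup>2 - 2 * z * d = 0" using q[of 1 "-d"] by simp
  have q4: "1 + 2 * c1 * g + 2 * c2 * d - l * g\<^sup>2 - m * d\<^sup>2 + 2 * z * (g * d) = 0"
    using q[of "-g" "-d"] by simp
  have "2 * z * ((1 + g) * (1 + d)) = 0"
    using q1 q2 q3 q4 by (simp add: algebra_simps)
  then have z0: "z = 0" using g d by simp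
  have "(1 + g) * (2 * c1 + l * (1 - g)) = 0"
    using q1 q2 z0 by (simp add: algebra_simps power2_eq_square)
  then have c1: "c1 = - (l * (1 - g) / 2)" using g by simp
  have "(1 + d) * (2 * c2 + m * (1 - d)) = 0"
    using q1 q3 z0 by (simp add: algebra_simps power2_eq_square)
  then have c2: "c2 = - (m * (1 - d) / 2)" using d by simp
  have lm1: "l * g + m * d = 1"
    using q1 z0 unfolding c1 c2 by (simp add: field_simps)
  have "X1 * Y2 - X2 * Y1 \<noteq> 0 \<Longrightarrow> (X1 * Y2 - X2 * Y1)\<^sup>2 > 0" by simp
  moreover have "(X1 * Y2 - X2 * Y1)\<^sup>2 = V * W - Z\<^sup>2"
    unfolding V_def W_def Z_def by (simp add: power2_eq_square algebra_simps)
  ultimately have cs: "V * W - Z\<^sup>2 > 0" using det by simp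
  (* det^2 = V W - Z^2 by Lagrange's identity; N is the factor left after taking out l m. *)
  define N where "N = l * ((1 + g) / 2)\<^sup>2 + m * ((1 + d) / 2)\<^sup>2"
  have "V * W - Z\<^sup>2 = (l + c1\<^sup>2) * (m + c2\<^sup>2) - (c1 * c2)\<^sup>2"
    using z0 by (simp add: l_def m_def z_def)
  also have "\<dots> = l * m * (1 + l * ((1 - g) / 2)\<^sup>2 + m * ((1 - d) / 2)\<^sup>2)"
    unfolding c1 c2 by (simp add: power2_eq_square field_simps)
  also have "1 + l * ((1 - g) / 2)\<^sup>2 + m * ((1 - d) / 2)\<^sup>2 = N"
  proof -
    have "N - (l * ((1 - g) / 2)\<^sup>2 + m * ((1 - d) / 2)\<^sup>2) = l * g + m * d"
      unfolding N_def by (simp add: power2_eq_square field_simps)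
    then show ?thesis using lm1 by simp
  qed
  finally have lmN: "l * m * N > 0" using cs by simp
  have "(1 - (c1 + c2)) + (1 - (c1 - d * c2)) + (1 - (c2 - g * c1)) + (1 - (- g * c1 - d * c2)) > 0"
  proof -
    have "1 - (c1 + c2) > 0" "1 - (c1 - d * c2) > 0" "1 - (c2 - g * c1) > 0" "1 - (- g * c1 - d * c2) > 0"
      using inside[of 1 1] inside[of 1 "-d"] inside[of "-g" 1] inside[of "-g" "-d"] by simp_all
    then show ?thesis by (intro add_pos_pos)
  qed
  moreover have "(1 - (c1 + c2)) + (1 - (c1 - d * c2)) + (1 - (c2 - g * c1)) + (1 - (- g * c1 - d * c2))
      = 4 * (l * g + m * d) - 2 * c1 * (1 - g) - 2 * c2 * (1 - d)"
    unfolding lm1 by (simp add: algebra_simps)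
  moreover have "\<dots> = 4 * N"
    unfolding c1 c2 N_def by (simp add: power2_eq_square field_simps)
  ultimately have "N > 0" by simp
  with lmN have lm: "l * m > 0" by (simp add: zero_less_mult_iff)
  have "l > 0" "m > 0"
  proof -
    have "\<not> (l < 0 \<and> m < 0)"
      using lm1 g d by (smt (verit) mult_neg_pos)
    then show "l > 0" "m > 0" using lm by (auto simp: zero_less_mult_iff)
  qed
  moreover have "V = c1\<^sup>2 + l" by (simp add: l_def)
  moreover have "W = c2\<^sup>2 + m" by (simp add: m_def)
  moreover have "Z = c1 * c2" using z0 by (simp add: z_def)
  ultimately show ?thesis
    using that[of l m] lm1 c1 c2 unfolding V_def W_def Z_def by blast
qed

text \<open>
  The point equation of the member of the pencil of dual conics whose coefficient ratio is
  \<open>m / l = t (1 + g) / (1 + d)\<close>. With this normalisation \<open>t\<close> enters only through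
  \<open>t x\<^sup>2 + y\<^sup>2 / t\<close>, and the contact points with the sides are those with
  \<open>t \<bar>x\<bar> = \<bar>y\<bar>\<close>.
\<close>

definition conic_eq :: "real \<Rightarrow> real \<Rightarrow> real \<Rightarrow> real \<Rightarrow> real \<Rightarrow> bool" where
  "conic_eq g d t x y \<longleftrightarrow> (1 - x * (1 - g) / 2 - y * (1 - d) / 2)\<^sup>2 =
     (x * (1 + g) / 2)\<^sup>2 + (y * (1 + d) / 2)\<^sup>2 + (1 + g) * (1 + d) / 4 * (t * x\<^sup>2 + y\<^sup>2 / t)"

text \<open>
  Passage between a dual conic and its point equation. The right-hand side is the usual equation of an
  ellipse with centre \<open>(c1, c2)\<close>; both equations agree up to the factor \<open>l m\<close> because of
  \<open>l g + m d = 1\<close>.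
\<close>

lemma conic_eq_dual:
  fixes l m g d :: real
  assumes l: "l > 0" and m: "m > 0" and g: "g > 0" and d: "d > 0" and lm: "l * g + m * d = 1"
    and c1: "c1 = - (l * (1 - g) / 2)" and c2: "c2 = - (m * (1 - d) / 2)"
  shows "conic_eq g d ((1 + d) * m / ((1 + g) * l)) x y \<longleftrightarrow>
    (c2\<^sup>2 + m) * (x - c1)\<^sup>2 - 2 * (c1 * c2) * (x - c1) * (y - c2) + (c1\<^sup>2 + l) * (y - c2)\<^sup>2
      = (c1\<^sup>2 + l) * (c2\<^sup>2 + m) - (c1 * c2)\<^sup>2"
proof -
  define p where "p = (1 - g) / 2"
  define q where "q = (1 - d) / 2"
  define h where "h = (1 + g) / 2"
  define k where "k = (1 + d) / 2"
  have pos: "h > 0" "k > 0" using g d by (simp_all add: h_def k_def)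
  have gh: "g = h\<^sup>2 - p\<^sup>2" and dk: "d = k\<^sup>2 - q\<^sup>2"
    by (simp_all add: h_def p_def k_def q_def power2_eq_square field_simps)
  have c: "c1 = - (l * p)" "c2 = - (m * q)" by (simp_all add: c1 c2 p_def q_def)
  have t: "(1 + d) * m / ((1 + g) * l) = k * m / (h * l)"
  proof -
    have "1 + d = 2 * k" "1 + g = 2 * h" by (simp_all add: h_def k_def)
    then show ?thesis by simp
  qed
  have lm': "l * (h\<^sup>2 - p\<^sup>2) + m * (k\<^sup>2 - q\<^sup>2) = 1" using lm gh dk by simp
  have e: "(1 + g) * (1 + d) / 4 = h * k"
    by (simp add: h_def k_def)
  have "(x * h)\<^sup>2 + (y * k)\<^sup>2 + h * k * (k * m / (h * l) * x\<^sup>2 + y\<^sup>2 / (k * m / (h * l)))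
      = (x\<^sup>2 / l + y\<^sup>2 / m) * (l * h\<^sup>2 + m * k\<^sup>2)"
    using pos l m by (simp add: field_simps power2_eq_square)
  then have "conic_eq g d ((1 + d) * m / ((1 + g) * l)) x y \<longleftrightarrow>
      (1 - x * p - y * q)\<^sup>2 = (x\<^sup>2 / l + y\<^sup>2 / m) * (l * h\<^sup>2 + m * k\<^sup>2)"
    unfolding conic_eq_def t e by (simp add: p_def q_def h_def k_def)
  also have "\<dots> \<longleftrightarrow> l * m * (1 - x * p - y * q)\<^sup>2 = l * m * ((x\<^sup>2 / l + y\<^sup>2 / m) * (l * h\<^sup>2 + m * k\<^sup>2))"
    using l m by simp
  also have "l * m * ((x\<^sup>2 / l + y\<^sup>2 / m) * (l * h\<^sup>2 + m * k\<^sup>2)) = (m * x\<^sup>2 + l * y\<^sup>2) * (l * h\<^sup>2 + m * k\<^sup>2)"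
    using l m by (simp add: field_simps)
  also have "l * h\<^sup>2 + m * k\<^sup>2 = 1 + l * p\<^sup>2 + m * q\<^sup>2"
    using lm' by (simp add: algebra_simps)
  finally show ?thesis
    unfolding c by (simp add: power2_eq_square algebra_simps) (auto simp: algebra_simps)
qed

section \<open>Counting the ellipses of the pencil through a point\<close>

text \<open>
  After multiplication by \<open>t\<close> this is a quadratic equation with positive discriminant; both roots are
  positive since their sum and their product are.
\<close>

lemma two_roots:
  fixes x y M :: real
  assumes "x \<noteq> 0" "y \<noteq> 0" "M > 2 * (\<bar>x\<bar> * \<bar>y\<bar>)"
  shows "card {t. t > 0 \<and> t * x\<^sup>2 + y\<^sup>2 / t = M} = 2"
proof -
  define r where "r = sqrt (M\<^sup>2 - (2 * (\<bar>x\<bar> * \<bar>y\<bar>))\<^sup>2)"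
  have M: "M > 0" using assms by (smt (verit) mult_nonneg_nonneg)
  have "(2 * (\<bar>x\<bar> * \<bar>y\<bar>))\<^sup>2 < M\<^sup>2"
    using assms by (intro power_strict_mono) auto
  then have r: "r > 0" and r2: "r\<^sup>2 = M\<^sup>2 - 4 * (x\<^sup>2 * y\<^sup>2)"
    by (auto simp: r_def power_mult_distrib)
  have "r\<^sup>2 < M\<^sup>2" using r2 assms by simp
  then have rM: "r < M" using M by (simp add: power2_less_imp_less)
  have "{t. t > 0 \<and> t * x\<^sup>2 + y\<^sup>2 / t = M} = {(M + r) / (2 * x\<^sup>2), (M - r) / (2 * x\<^sup>2)}"
  proof (intro set_eqI)
    fix t :: real
    let ?q = "(2 * x\<^sup>2 * t - (M + r)) * (2 * x\<^sup>2 * t - (M - r))"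
    have q: "?q = 4 * x\<^sup>2 * (t\<^sup>2 * x\<^sup>2 + y\<^sup>2 - M * t)"
    proof -
      have "?q = 4 * x\<^sup>2 * (t\<^sup>2 * x\<^sup>2 - M * t) + (M\<^sup>2 - r\<^sup>2)"
        by (simp add: power2_eq_square algebra_simps)
      then show ?thesis unfolding r2 by (simp add: algebra_simps)
    qed
    have "?q = 0 \<longleftrightarrow> t\<^sup>2 * x\<^sup>2 + y\<^sup>2 - M * t = 0"
      unfolding q using assms by simp
    then have "t > 0 \<and> t * x\<^sup>2 + y\<^sup>2 / t = M \<longleftrightarrow> t > 0 \<and> ?q = 0"
      by (auto simp: field_simps power2_eq_square)
    also have "\<dots> \<longleftrightarrow> t > 0 \<and> (t = (M + r) / (2 * x\<^sup>2) \<or> t = (M - r) / (2 * x\<^sup>2))"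
    proof -
      have "2 * x\<^sup>2 * t - w = 0 \<longleftrightarrow> t = w / (2 * x\<^sup>2)" for w
        using assms by (simp add: eq_divide_eq mult.commute)
      then show ?thesis by (simp only: mult_eq_0_iff)
    qed
    also have "\<dots> \<longleftrightarrow> t \<in> {(M + r) / (2 * x\<^sup>2), (M - r) / (2 * x\<^sup>2)}"
      using assms r rM M by auto
    finally show "t \<in> {t. t > 0 \<and> t * x\<^sup>2 + y\<^sup>2 / t = M} \<longleftrightarrow>
      t \<in> {(M + r) / (2 * x\<^sup>2), (M - r) / (2 * x\<^sup>2)}" by simp
  qed
  moreover have "(M + r) / (2 * x\<^sup>2) \<noteq> (M - r) / (2 * x\<^sup>2)"
    using r assms by (simp add: field_simps)
  ultimately show ?thesis by simp
qed

lemma one_root: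
  fixes x y M :: real
  assumes "x \<noteq> 0 \<or> y \<noteq> 0" and "x = 0 \<or> y = 0" and "M > 0"
  shows "\<exists>!t. t > 0 \<and> t * x\<^sup>2 + y\<^sup>2 / t = M"
proof (cases "x = 0")
  case True
  with assms show ?thesis
    by (intro ex1I[of _ "y\<^sup>2 / M"]) (auto simp: field_simps)
next
  case False
  with assms show ?thesis
    by (intro ex1I[of _ "M / x\<^sup>2"]) (auto simp: field_simps)
qed

text \<open>
  The arithmetic-geometric mean inequality for \<open>t x\<^sup>2\<close> and \<open>y\<^sup>2 / t\<close>, as a complete square.
\<close>

lemma double_root:
  fixes x y t :: real
  assumes "t > 0"
  shows "t * x\<^sup>2 + y\<^sup>2 / t = 2 * (\<bar>x\<bar> * \<bar>y\<bar>) \<longleftrightarrow> t * \<bar>x\<bar> = \<bar>y\<bar>"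
    and "t * x\<^sup>2 + y\<^sup>2 / t \<ge> 2 * (\<bar>x\<bar> * \<bar>y\<bar>)"
proof -
  have "t * x\<^sup>2 + y\<^sup>2 / t - 2 * (\<bar>x\<bar> * \<bar>y\<bar>) = (t * \<bar>x\<bar> - \<bar>y\<bar>)\<^sup>2 / t"
    using assms by (simp add: power2_diff power_mult_distrib field_simps) (simp add: power2_eq_square)
  moreover have "(t * \<bar>x\<bar> - \<bar>y\<bar>)\<^sup>2 / t \<ge> 0" using assms by simp
  moreover have "(t * \<bar>x\<bar> - \<bar>y\<bar>)\<^sup>2 / t = 0 \<longleftrightarrow> t * \<bar>x\<bar> = \<bar>y\<bar>" using assms by simp
  ultimately show "t * x\<^sup>2 + y\<^sup>2 / t = 2 * (\<bar>x\<bar> * \<bar>y\<bar>) \<longleftrightarrow> t * \<bar>x\<bar> = \<bar>y\<bar>"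
    "t * x\<^sup>2 + y\<^sup>2 / t \<ge> 2 * (\<bar>x\<bar> * \<bar>y\<bar>)" by linarith+
qed

text \<open>
  The maximum of \<open>u x + v y\<close> over the corners of a rectangle is its value at the midpoint of the
  rectangle plus the half widths times \<open>\<bar>x\<bar>\<close> and \<open>\<bar>y\<bar>\<close>.
\<close>

lemma rectangle_support_iff:
  fixes x y g d :: real
  assumes "g > 0" "d > 0"
  defines "S \<equiv> \<bar>x\<bar> * (1 + g) / 2 + \<bar>y\<bar> * (1 + d) / 2"
    and "L \<equiv> 1 - x * (1 - g) / 2 - y * (1 - d) / 2"
  shows "(\<forall>u\<in>{1, -g}. \<forall>v\<in>{1, -d}. u * x + v * y \<le> 1) \<longleftrightarrow> S \<le> L"
    and "(\<forall>u\<in>{1, -g}. \<forall>v\<in>{1, -d}. u * x + v * y < 1) \<longleftrightarrow> S < L"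
proof -
  have sgn: "g * x \<ge> 0 \<longleftrightarrow> x \<ge> 0" "d * y \<ge> 0 \<longleftrightarrow> y \<ge> 0"
    using assms by (simp_all add: zero_le_mult_iff)
  have "\<bar>g * x\<bar> = g * \<bar>x\<bar>" "\<bar>d * y\<bar> = d * \<bar>y\<bar>"
    using assms by (simp_all add: abs_mult)
  then have S: "2 * S = \<bar>x\<bar> + \<bar>g * x\<bar> + \<bar>y\<bar> + \<bar>d * y\<bar>"
    by (simp add: S_def field_simps)
  have L: "2 * L = 2 - x + g * x - y + d * y"
    by (simp add: L_def field_simps)
  have mx: "max x (- (g * x)) = (\<bar>x\<bar> + \<bar>g * x\<bar> + x - g * x) / 2"
    using sgn(1) by (cases "x \<ge> 0") (simp_all add: max_def)
  have my: "max y (- (d * y)) = (\<bar>y\<bar> + \<bar>d * y\<bar> + y - d * y) / 2"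
    using sgn(2) by (cases "y \<ge> 0") (simp_all add: max_def)
  have m: "max x (- (g * x)) + max y (- (d * y)) = 1 + (S - L)"
    using S L unfolding mx my by argo
  have "(\<forall>u\<in>{1, -g}. \<forall>v\<in>{1, -d}. u * x + v * y \<le> 1)
      \<longleftrightarrow> max x (- (g * x)) + max y (- (d * y)) \<le> 1"
    unfolding max_def by auto
  also have "\<dots> \<longleftrightarrow> S \<le> L"
    unfolding m by simp
  finally show "(\<forall>u\<in>{1, -g}. \<forall>v\<in>{1, -d}. u * x + v * y \<le> 1) \<longleftrightarrow> S \<le> L" .
  have "(\<forall>u\<in>{1, -g}. \<forall>v\<in>{1, -d}. u * x + v * y < 1)
      \<longleftrightarrow> max x (- (g * x)) + max y (- (d * y)) < 1"
    unfolding max_def by auto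
  also have "\<dots> \<longleftrightarrow> S < L"
    unfolding m by simp
  finally show "(\<forall>u\<in>{1, -g}. \<forall>v\<in>{1, -d}. u * x + v * y < 1) \<longleftrightarrow> S < L" .
qed

text \<open>
  For fixed \<open>(x, y)\<close> the incidence condition becomes an equation \<open>t x\<^sup>2 + y\<^sup>2 / t = M\<close> for the
  parameter. Here \<open>M\<close> exceeds the minimum \<open>2 \<bar>x\<bar> \<bar>y\<bar>\<close> of the left-hand side exactly by a positive
  multiple of \<open>L\<^sup>2 - S\<^sup>2\<close>, which is positive inside the quadrilateral and zero on its boundary.
\<close>

lemma conic_eq_pencil:
  fixes x y g d t :: real
  assumes g: "g > 0" and d: "d > 0" and t: "t > 0"
  defines "S \<equiv> \<bar>x\<bar> * (1 + g) / 2 + \<bar>y\<bar> * (1 + d) / 2"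
    and "L \<equiv> 1 - x * (1 - g) / 2 - y * (1 - d) / 2"
  shows "conic_eq g d t x y \<longleftrightarrow>
    t * x\<^sup>2 + y\<^sup>2 / t = 2 * (\<bar>x\<bar> * \<bar>y\<bar>) + 4 * (L\<^sup>2 - S\<^sup>2) / ((1 + g) * (1 + d))"
proof -
  have "S\<^sup>2 = (x * (1 + g) / 2)\<^sup>2 + (y * (1 + d) / 2)\<^sup>2 + (1 + g) * (1 + d) / 4 * (2 * (\<bar>x\<bar> * \<bar>y\<bar>))"
    unfolding S_def by (simp add: power2_sum power_mult_distrib power_divide)
  moreover have "L2 = a + b + K * M \<longleftrightarrow> M = N + (L2 - S2) / K"
    if "S2 = a + b + K * N" and "K > 0" for L2 S2 a b K M N :: real
    using that by (auto simp: field_simps)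
  moreover have "(1 + g) * (1 + d) / 4 > 0" using g d by simp
  ultimately have "conic_eq g d t x y \<longleftrightarrow>
    t * x\<^sup>2 + y\<^sup>2 / t = 2 * (\<bar>x\<bar> * \<bar>y\<bar>) + (L\<^sup>2 - S\<^sup>2) / ((1 + g) * (1 + d) / 4)"
    unfolding conic_eq_def L_def[symmetric] by blast
  then show ?thesis by (simp add: mult.commute)
qed

text \<open>
  The mean inequality only yields \<open>S \<le> \<bar>L\<bar>\<close>; negative \<open>L\<close> is excluded because \<open>S + L \<ge> 1\<close>.
\<close>

lemma conic_eq_inside:
  fixes x y g d t :: real
  assumes g: "g > 0" and d: "d > 0" and t: "t > 0" and E: "conic_eq g d t x y"
  defines "S \<equiv> \<bar>x\<bar> * (1 + g) / 2 + \<bar>y\<bar> * (1 + d) / 2"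
    and "L \<equiv> 1 - x * (1 - g) / 2 - y * (1 - d) / 2"
  shows "S \<le> L"
proof -
  have "t * x\<^sup>2 + y\<^sup>2 / t = 2 * (\<bar>x\<bar> * \<bar>y\<bar>) + 4 * (L\<^sup>2 - S\<^sup>2) / ((1 + g) * (1 + d))"
    using E unfolding conic_eq_pencil[OF g d t] S_def L_def .
  then have "0 \<le> 4 * (L\<^sup>2 - S\<^sup>2) / ((1 + g) * (1 + d))"
    using double_root(2)[OF t, of x y] by simp
  moreover have "(1 + g) * (1 + d) > 0" using g d by simp
  ultimately have "S\<^sup>2 \<le> L\<^sup>2" by (auto simp: zero_le_divide_iff)
  moreover have S0: "S \<ge> 0" using g d by (simp add: S_def)
  ultimately have "S \<le> \<bar>L\<bar>" by (metis abs_le_square_iff abs_of_nonneg)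
  moreover have "\<not> S \<le> - L"
  proof -
    have "x * (1 - g) \<le> \<bar>x\<bar> * (1 + g)" "y * (1 - d) \<le> \<bar>y\<bar> * (1 + d)"
      using g d by (simp_all add: abs_if algebra_simps)
    moreover have "S + L = 1 + (\<bar>x\<bar> * (1 + g) - x * (1 - g)) / 2 + (\<bar>y\<bar> * (1 + d) - y * (1 - d)) / 2"
      by (simp add: S_def L_def diff_divide_distrib)
    ultimately have "S + L \<ge> 1" by simp
    then show ?thesis by simp
  qed
  ultimately show ?thesis by linarith
qed

lemma conic_eq_boundary:
  fixes x y g d t :: real
  assumes "g > 0" "d > 0" "t > 0"
    and "\<bar>x\<bar> * (1 + g) / 2 + \<bar>y\<bar> * (1 + d) / 2 = 1 - x * (1 - g) / 2 - y * (1 - d) / 2"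
  shows "conic_eq g d t x y \<longleftrightarrow> t * \<bar>x\<bar> = \<bar>y\<bar>"
proof -
  have "conic_eq g d t x y \<longleftrightarrow> t * x\<^sup>2 + y\<^sup>2 / t = 2 * (\<bar>x\<bar> * \<bar>y\<bar>)"
    unfolding conic_eq_pencil[OF assms(1-3)] assms(4) by simp
  also have "\<dots> \<longleftrightarrow> t * \<bar>x\<bar> = \<bar>y\<bar>"
    by (rule double_root(1)[OF assms(3)])
  finally show ?thesis .
qed

section \<open>Coordinates along the diagonals\<close>

lemma convex_corner:
  fixes P M N :: "'a::real_vector"
  assumes "convex K" "P \<in> K" "M \<in> K" "N \<in> K" "a \<ge> 0" "b \<ge> 0" "a + b \<le> 1"
  shows "P + a *\<^sub>R (M - P) + b *\<^sub>R (N - P) \<in> K"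
proof -
  have "P + a *\<^sub>R (M - P) + b *\<^sub>R (N - P) = (1 - a - b) *\<^sub>R P + a *\<^sub>R M + b *\<^sub>R N"
    by (simp add: algebra_simps)
  moreover have "\<dots> \<in> convex hull {P, M, N}"
    using assms unfolding convex_hull_3
    by (intro CollectI exI[of _ "1 - a - b"] exI[of _ a] exI[of _ b]) auto
  moreover have "convex hull {P, M, N} \<subseteq> K"
    using assms by (intro hull_minimal) auto
  ultimately show ?thesis by auto
qed

lemma closed_segment_opposite_corner:
  fixes P M N :: "'a::real_vector"
  assumes "a \<ge> 0" "b \<ge> 0" "a + b = 1"
  shows "P + a *\<^sub>R (M - P) + b *\<^sub>R (N - P) \<in> closed_segment M N"
proof -
  have a: "a = 1 - b" using assms by simp
  have "P + a *\<^sub>R (M - P) + b *\<^sub>R (N - P) = (1 - b) *\<^sub>R M + b *\<^sub>R N"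
    unfolding a by (simp add: algebra_simps)
  then show ?thesis using assms unfolding in_segment by auto
qed

text \<open>
  Affine coordinates along the diagonals: \<open>P\<close> is the origin, \<open>A\<close> and \<open>B\<close> are the unit points, and
  \<open>\<xi>\<close>, \<open>\<eta>\<close> is the basis dual to \<open>A - P\<close>, \<open>B - P\<close>. In these coordinates
  \<open>C = (- 1 / g, 0)\<close> and \<open>D = (0, - 1 / d)\<close>, so that the four sides lie on the lines
  \<open>u x + v y = 1\<close> with \<open>u \<in> {1, -g}\<close> and \<open>v \<in> {1, -d}\<close>.
\<close>

locale diagonal_frame =
  fixes A B C D P \<xi> \<eta> :: "real^2" and g d :: real
  assumes g: "g > 0" and d: "d > 0"
    and \<xi>: "\<xi> \<bullet> (A - P) = 1" "\<xi> \<bullet> (B - P) = 0"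
    and \<eta>: "\<eta> \<bullet> (A - P) = 0" "\<eta> \<bullet> (B - P) = 1"
    and C: "C = P - (1 / g) *\<^sub>R (A - P)" and D: "D = P - (1 / d) *\<^sub>R (B - P)"
begin

definition X :: "real^2 \<Rightarrow> real" where "X z = \<xi> \<bullet> (z - P)"
definition Y :: "real^2 \<Rightarrow> real" where "Y z = \<eta> \<bullet> (z - P)"
definition pt :: "real \<Rightarrow> real \<Rightarrow> real^2" where "pt x y = P + x *\<^sub>R (A - P) + y *\<^sub>R (B - P)"

lemma det_frame: "det2 \<xi> \<eta> \<noteq> 0" "det2 (A - P) (B - P) \<noteq> 0"
proof -
  have "det2 \<xi> \<eta> * det2 (A - P) (B - P) =
      (\<xi> \<bullet> (A - P)) * (\<eta> \<bullet> (B - P)) - (\<xi> \<bullet> (B - P)) * (\<eta> \<bullet> (A - P))"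
    unfolding det2_def inner_vec_def sum_2 inner_real_def by (simp only: algebra_simps)
  then have "det2 \<xi> \<eta> * det2 (A - P) (B - P) = 1" using \<xi> \<eta> by simp
  then show "det2 \<xi> \<eta> \<noteq> 0" "det2 (A - P) (B - P) \<noteq> 0" by auto
qed

lemma X_pt [simp]: "X (pt x y) = x" and Y_pt [simp]: "Y (pt x y) = y"
  by (simp_all add: X_def Y_def pt_def \<xi> \<eta> inner_add_right)

lemma pt_X_Y [simp]: "pt (X z) (Y z) = z"
proof -
  obtain s r where "z - P = s *\<^sub>R (A - P) + r *\<^sub>R (B - P)"
    using det2_expand[OF det_frame(2)] .
  then have "z = pt s r" by (simp add: pt_def algebra_simps)
  then show ?thesis by simp
qed

lemma vertex_coordinates [simp]:
  "X A = 1" "Y A = 0" "X B = 0" "Y B = 1" "X C = - (1 / g)" "Y C = 0" "X D = 0" "Y D = - (1 / d)"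
  "X P = 0" "Y P = 0"
  by (simp_all add: X_def Y_def \<xi> \<eta> C D)

lemma eq_iff_coordinates: "z = w \<longleftrightarrow> X z = X w \<and> Y z = Y w"
  by (metis pt_X_Y)

definition normal :: "real \<Rightarrow> real \<Rightarrow> real^2" where "normal u v = u *\<^sub>R \<xi> + v *\<^sub>R \<eta>"

lemma normal_inner: "normal u v \<bullet> z = normal u v \<bullet> P + u * X z + v * Y z"
  by (simp add: normal_def X_def Y_def inner_add_left inner_diff_right algebra_simps)

lemma normal_nonzero:
  assumes "u \<noteq> 0"
  shows "normal u v \<noteq> 0"
proof
  assume "normal u v = 0"
  moreover have "det2 (normal u v) \<eta> = u * det2 \<xi> \<eta>"
    by (simp add: normal_def det2_def algebra_simps)
  ultimately show False using assms det_frame by (simp add: det2_def)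
qed

text \<open>
  For the nontrivial inclusion, a point in the sector spanned by two neighbouring vertices is a convex
  combination of these and of \<open>P\<close>; the sign pattern of its coordinates selects the sector.
\<close>

lemma hull_halfplanes:
  "convex hull {A, B, C, D} =
    (\<Inter>u\<in>{1, -g}. \<Inter>v\<in>{1, -d}. {z. normal u v \<bullet> z \<le> normal u v \<bullet> P + 1})" (is "?H = ?Q")
proof
  have "convex ?Q" by (intro convex_INT convex_halfspace_le)
  moreover have "{A, B, C, D} \<subseteq> ?Q"
    using g d by (auto simp: normal_inner[of _ _ A] normal_inner[of _ _ B] normal_inner[of _ _ C]
        normal_inner[of _ _ D] intro: order_trans[of _ 0])
  ultimately show "?H \<subseteq> ?Q" by (rule hull_minimal[rotated])
next
  show "?Q \<subseteq> ?H"
  proof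
    fix z assume "z \<in> ?Q"
    then have q: "X z + Y z \<le> 1" "X z - d * Y z \<le> 1" "- g * X z + Y z \<le> 1" "- g * X z - d * Y z \<le> 1"
      by (auto simp: normal_inner[of _ _ z])
    have vs: "A \<in> ?H" "B \<in> ?H" "C \<in> ?H" "D \<in> ?H" by (auto intro: hull_inc)
    have "P = (1 / (1 + g)) *\<^sub>R A + (g / (1 + g)) *\<^sub>R C"
    proof -
      have "(1 + g) *\<^sub>R P = A + g *\<^sub>R C" using g by (simp add: C algebra_simps)
      then have "(1 / (1 + g)) *\<^sub>R (1 + g) *\<^sub>R P = (1 / (1 + g)) *\<^sub>R (A + g *\<^sub>R C)" by simp
      then show ?thesis using g by (simp add: scaleR_add_right)
    qed
    moreover have "1 / (1 + g) + g / (1 + g) = 1" using g by (simp add: field_simps)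
    ultimately have P: "P \<in> ?H"
      using convexD[OF convex_convex_hull vs(1) vs(3), of "1 / (1 + g)" "g / (1 + g)"] g by simp
    have AC: "A - P = - g *\<^sub>R (C - P)" using g by (simp add: C)
    have BD: "B - P = - d *\<^sub>R (D - P)" using d by (simp add: D)
    note H = convex_corner[OF convex_convex_hull P]
    have z: "z = P + X z *\<^sub>R (A - P) + Y z *\<^sub>R (B - P)"
      using pt_X_Y[of z] unfolding pt_def by simp
    consider "X z \<ge> 0" "Y z \<ge> 0" | "X z \<ge> 0" "Y z \<le> 0" | "X z \<le> 0" "Y z \<ge> 0" | "X z \<le> 0" "Y z \<le> 0"
      by linarith
    then show "z \<in> ?H"
    proof cases
      case 1
      then show ?thesis using H[OF vs(1,2), of "X z" "Y z"] q z by simp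
    next
      case 2
      moreover have "z = P + X z *\<^sub>R (A - P) + (- d * Y z) *\<^sub>R (D - P)"
        using z unfolding BD by (simp add: algebra_simps)
      ultimately show ?thesis using H[OF vs(1,4), of "X z" "- d * Y z"] q d
        by (simp add: mult_le_0_iff)
    next
      case 3
      moreover have "z = P + (- g * X z) *\<^sub>R (C - P) + Y z *\<^sub>R (B - P)"
        using z unfolding AC by (simp add: algebra_simps)
      ultimately show ?thesis using H[OF vs(3,2), of "- g * X z" "Y z"] q g
        by (simp add: mult_le_0_iff)
    next
      case 4
      moreover have "z = P + (- g * X z) *\<^sub>R (C - P) + (- d * Y z) *\<^sub>R (D - P)"
        using z unfolding AC BD by (simp add: algebra_simps)
      ultimately show ?thesis using H[OF vs(3,4), of "- g * X z" "- d * Y z"] q g d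
        by (simp add: mult_le_0_iff)
    qed
  qed
qed

text \<open>
  \<open>L z - S z\<close> is the smallest of the four numbers \<open>1 - (u X z + v Y z)\<close> belonging to the sides;
  \<open>L\<close> is the value of this expression at the midpoint of the rectangle of coefficients \<open>(u, v)\<close>,
  and \<open>S\<close> weighs the coordinates with its half widths.
\<close>

definition S :: "real^2 \<Rightarrow> real" where
  "S z = \<bar>X z\<bar> * (1 + g) / 2 + \<bar>Y z\<bar> * (1 + d) / 2"
definition L :: "real^2 \<Rightarrow> real" where
  "L z = 1 - X z * (1 - g) / 2 - Y z * (1 - d) / 2"

lemma hull_iff: "z \<in> convex hull {A, B, C, D} \<longleftrightarrow> S z \<le> L z"
  unfolding S_def L_def rectangle_support_iff(1)[OF g d, symmetric] hull_halfplanes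
  by (simp add: normal_inner[of _ _ z])

lemma interior_hull_iff: "z \<in> interior (convex hull {A, B, C, D}) \<longleftrightarrow> S z < L z"
proof -
  have "interior (convex hull {A, B, C, D}) =
    (\<Inter>u\<in>{1, -g}. \<Inter>v\<in>{1, -d}. {z. normal u v \<bullet> z < normal u v \<bullet> P + 1})"
    unfolding hull_halfplanes using g by (simp add: interior_Int normal_nonzero)
  then show ?thesis
    unfolding S_def L_def rectangle_support_iff(2)[OF g d, symmetric]
    by (simp add: normal_inner[of _ _ z])
qed

lemma frontier_hull_iff: "z \<in> frontier (convex hull {A, B, C, D}) \<longleftrightarrow> S z = L z"
proof -
  have "closed (convex hull {A, B, C, D})"
    by (intro compact_imp_closed compact_convex_hull finite_imp_compact) simp
  then have "frontier (convex hull {A, B, C, D}) =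
      convex hull {A, B, C, D} - interior (convex hull {A, B, C, D})"
    by (simp add: frontier_def)
  then show ?thesis using hull_iff interior_hull_iff by auto
qed

section \<open>The inscribed ellipses\<close>

definition conic :: "real \<Rightarrow> (real^2) set" where
  "conic t = {z. conic_eq g d t (X z) (Y z)}"

text \<open>
  The dual conic with the coefficient ratio prescribed by \<open>t\<close>, normalised by \<open>l g + m d = 1\<close>, gives
  the centre and the quadratic form. Its matrix has rows \<open>(W, -Z)\<close> and \<open>(-Z, V)\<close> and positive
  determinant, so completing the square writes it as a sum of two squares.
\<close>

lemma ellipse_conic:
  assumes t: "t > 0"
  shows "ellipse (conic t)"
proof -
  define \<rho> where "\<rho> = t * (1 + g) / (1 + d)"
  define l where "l = 1 / (g + d * \<rho>)"
  define m where "m = \<rho> * l"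
  define c1 where "c1 = - (l * (1 - g) / 2)"
  define c2 where "c2 = - (m * (1 - d) / 2)"
  have \<rho>: "\<rho> > 0" using t g d by (simp add: \<rho>_def)
  have l: "l > 0" using \<rho> g d by (simp add: l_def add_pos_pos)
  have m: "m > 0" using \<rho> l by (simp add: m_def)
  have "l * (g + d * \<rho>) = 1" using l unfolding l_def by (metis divide_eq_0_iff less_irrefl nonzero_eq_divide_eq)
  then have lm: "l * g + m * d = 1" by (simp add: m_def algebra_simps)
  have teq: "(1 + d) * m / ((1 + g) * l) = t"
    using l g d by (simp add: m_def \<rho>_def add_pos_pos less_imp_neq[symmetric])
  define V where "V = c1\<^sup>2 + l"
  define W where "W = c2\<^sup>2 + m"
  define Z where "Z = c1 * c2"
  have V: "V > 0" using l by (simp add: V_def add_nonneg_pos)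
  have VW: "V * W - Z\<^sup>2 > 0"
  proof -
    have "V * W - Z\<^sup>2 = l * m + (l * c2\<^sup>2 + m * c1\<^sup>2)"
      by (simp add: V_def W_def Z_def power2_eq_square algebra_simps)
    moreover have "\<dots> > 0" using l m by (intro add_pos_nonneg) auto
    ultimately show ?thesis by simp
  qed
  define r where "r = (1 / sqrt V) *\<^sub>R \<xi>"
  define s where "s = (1 / sqrt (V * (V * W - Z\<^sup>2))) *\<^sub>R (V *\<^sub>R \<eta> - Z *\<^sub>R \<xi>)"
  have "det2 (a *\<^sub>R \<xi>) (b *\<^sub>R (V *\<^sub>R \<eta> - Z *\<^sub>R \<xi>)) = a * b * V * det2 \<xi> \<eta>" for a b
    by (simp add: det2_def algebra_simps)
  then have "det2 r s = (1 / sqrt V) * (1 / sqrt (V * (V * W - Z\<^sup>2))) * V * det2 \<xi> \<eta>"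
    unfolding r_def s_def .
  then have "det2 r s \<noteq> 0" using V VW det_frame by simp
  then have ell: "ellipse {z. ((z - pt c1 c2) \<bullet> r)\<^sup>2 + ((z - pt c1 c2) \<bullet> s)\<^sup>2 = 1}"
    by (rule ellipse_sum_of_squares)
  have "((z - pt c1 c2) \<bullet> r)\<^sup>2 + ((z - pt c1 c2) \<bullet> s)\<^sup>2 = 1 \<longleftrightarrow> z \<in> conic t" for z
  proof -
    define x where "x = X z - c1"
    define y where "y = Y z - c2"
    have x: "(z - pt c1 c2) \<bullet> \<xi> = x"
      using X_pt[of c1 c2] by (simp add: x_def X_def inner_commute inner_diff_right)
    have y: "(z - pt c1 c2) \<bullet> \<eta> = y"
      using Y_pt[of c1 c2] by (simp add: y_def Y_def inner_commute inner_diff_right)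
    have "((z - pt c1 c2) \<bullet> r)\<^sup>2 = x\<^sup>2 / V"
      using V by (simp add: r_def x power_divide)
    moreover have "((z - pt c1 c2) \<bullet> s)\<^sup>2 = (V * y - Z * x)\<^sup>2 / (V * (V * W - Z\<^sup>2))"
      using V VW by (simp add: s_def inner_diff_right x y power_divide)
    ultimately have "((z - pt c1 c2) \<bullet> r)\<^sup>2 + ((z - pt c1 c2) \<bullet> s)\<^sup>2 = 1 \<longleftrightarrow>
        x\<^sup>2 / V + (V * y - Z * x)\<^sup>2 / (V * (V * W - Z\<^sup>2)) = 1" by simp
    also have "\<dots> \<longleftrightarrow> x\<^sup>2 * (V * W - Z\<^sup>2) + (V * y - Z * x)\<^sup>2 = V * (V * W - Z\<^sup>2)"
    proof -
      have "a / V + b / (V * K) = 1 \<longleftrightarrow> a * K + b = V * K" if "K > 0" for a b K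
        using that V by (auto simp: field_simps)
      from this[OF VW] show ?thesis .
    qed
    also have "x\<^sup>2 * (V * W - Z\<^sup>2) + (V * y - Z * x)\<^sup>2 = V * (W * x\<^sup>2 - 2 * Z * x * y + V * y\<^sup>2)"
      by (simp add: power2_eq_square algebra_simps)
    also have "\<dots> = V * (V * W - Z\<^sup>2) \<longleftrightarrow> W * x\<^sup>2 - 2 * Z * x * y + V * y\<^sup>2 = V * W - Z\<^sup>2"
      using V by simp
    also have "\<dots> \<longleftrightarrow> conic_eq g d ((1 + d) * m / ((1 + g) * l)) (X z) (Y z)"
      unfolding conic_eq_dual[OF l m g d lm c1_def c2_def] x_def y_def V_def W_def Z_def ..
    finally show ?thesis unfolding teq conic_def by simp
  qed
  then have "{z. ((z - pt c1 c2) \<bullet> r)\<^sup>2 + ((z - pt c1 c2) \<bullet> s)\<^sup>2 = 1} = conic t" by blast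
  with ell show ?thesis by simp
qed

lemma conic_subset_hull:
  assumes "t > 0"
  shows "conic t \<subseteq> convex hull {A, B, C, D}"
  using conic_eq_inside[OF g d assms] unfolding conic_def hull_iff S_def L_def subset_iff by blast

text \<open>
  On the boundary the equation for \<open>t\<close> is the equality case of the mean inequality.
\<close>

lemma conic_frontier:
  assumes "t > 0" "S z = L z"
  shows "z \<in> conic t \<longleftrightarrow> t * \<bar>X z\<bar> = \<bar>Y z\<bar>"
  using conic_eq_boundary[OF g d assms(1)] assms(2) unfolding conic_def S_def L_def by blast

text \<open>
  A side of the quadrilateral lies on a supporting line, so an ellipse in the quadrilateral is tangent
  to a side wherever it meets it.
\<close>

lemma tangent_to_side_at_of_hull:
  assumes E: "ellipse E" "E \<subseteq> convex hull {A, B, C, D}" and z: "z \<in> E"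
  shows "z \<in> closed_segment A B \<Longrightarrow> tangent_to_side_at E A B z"
    and "z \<in> closed_segment B C \<Longrightarrow> tangent_to_side_at E B C z"
    and "z \<in> closed_segment C D \<Longrightarrow> tangent_to_side_at E C D z"
    and "z \<in> closed_segment D A \<Longrightarrow> tangent_to_side_at E D A z"
proof -
  have le: "normal u v \<bullet> z \<le> normal u v \<bullet> P + 1" if "z \<in> E" "u \<in> {1, -g}" "v \<in> {1, -d}" for z u v
    using that E(2) unfolding hull_halfplanes by blast
  have T: "tangent_to_side_at E M N z"
    if "z \<in> closed_segment M N" "u \<in> {1, -g}" "v \<in> {1, -d}"
      "u * X M + v * Y M = 1" "u * X N + v * Y N = 1" for M N u v
  proof (rule supported_ellipse_tangent_to_side_at[OF E(1), of "normal u v" "normal u v \<bullet> P + 1"])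
    show "normal u v \<noteq> 0" using that g by (intro normal_nonzero) auto
    show "normal u v \<bullet> M = normal u v \<bullet> P + 1" "normal u v \<bullet> N = normal u v \<bullet> P + 1"
      using that by (simp_all add: normal_inner[of u v M] normal_inner[of u v N])
  qed (use that z le in auto)
  show "z \<in> closed_segment A B \<Longrightarrow> tangent_to_side_at E A B z"
    by (rule T[of A B 1 1]) simp_all
  show "z \<in> closed_segment B C \<Longrightarrow> tangent_to_side_at E B C z"
    by (rule T[of B C "-g" 1]) (use g in simp_all)
  show "z \<in> closed_segment C D \<Longrightarrow> tangent_to_side_at E C D z"
    by (rule T[of C D "-g" "-d"]) (use g d in simp_all)
  show "z \<in> closed_segment D A \<Longrightarrow> tangent_to_side_at E D A z"
    by (rule T[of D A 1 "-d"]) (use d in simp_all)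
qed

lemma side_points:
  shows "X z \<ge> 0 \<Longrightarrow> Y z \<ge> 0 \<Longrightarrow> X z + Y z = 1 \<Longrightarrow> z \<in> closed_segment A B"
    and "X z \<le> 0 \<Longrightarrow> Y z \<ge> 0 \<Longrightarrow> - g * X z + Y z = 1 \<Longrightarrow> z \<in> closed_segment B C"
    and "X z \<le> 0 \<Longrightarrow> Y z \<le> 0 \<Longrightarrow> - g * X z - d * Y z = 1 \<Longrightarrow> z \<in> closed_segment C D"
    and "X z \<ge> 0 \<Longrightarrow> Y z \<le> 0 \<Longrightarrow> X z - d * Y z = 1 \<Longrightarrow> z \<in> closed_segment D A"
proof -
  have z: "z = P + X z *\<^sub>R (A - P) + Y z *\<^sub>R (B - P)"
    using pt_X_Y[of z] unfolding pt_def by simp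
  have AC: "A - P = - g *\<^sub>R (C - P)" using g by (simp add: C)
  have BD: "B - P = - d *\<^sub>R (D - P)" using d by (simp add: D)
  show "X z \<ge> 0 \<Longrightarrow> Y z \<ge> 0 \<Longrightarrow> X z + Y z = 1 \<Longrightarrow> z \<in> closed_segment A B"
    using closed_segment_opposite_corner[of "X z" "Y z" P A B] z by simp
  show "z \<in> closed_segment B C" if "X z \<le> 0" "Y z \<ge> 0" "- g * X z + Y z = 1"
  proof -
    have "z = P + Y z *\<^sub>R (B - P) + (- g * X z) *\<^sub>R (C - P)"
      using z unfolding AC by (simp add: algebra_simps)
    then show ?thesis
      using closed_segment_opposite_corner[of "Y z" "- g * X z" P B C] that g by (simp add: mult_le_0_iff)
  qed
  show "z \<in> closed_segment C D" if "X z \<le> 0" "Y z \<le> 0" "- g * X z - d * Y z = 1"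
  proof -
    have "z = P + (- g * X z) *\<^sub>R (C - P) + (- d * Y z) *\<^sub>R (D - P)"
      using z unfolding AC BD by (simp add: algebra_simps)
    then show ?thesis
      using closed_segment_opposite_corner[of "- g * X z" "- d * Y z" P C D] that g d by (simp add: mult_le_0_iff)
  qed
  show "z \<in> closed_segment D A" if "X z \<ge> 0" "Y z \<le> 0" "X z - d * Y z = 1"
  proof -
    have "z = P + (- d * Y z) *\<^sub>R (D - P) + X z *\<^sub>R (A - P)"
      using z unfolding BD by (simp add: algebra_simps)
    then show ?thesis
      using closed_segment_opposite_corner[of "- d * Y z" "X z" P D A] that d by (simp add: mult_le_0_iff)
  qed
qed

lemma S_minus_L:
  "X z \<ge> 0 \<Longrightarrow> Y z \<ge> 0 \<Longrightarrow> S z - L z = X z + Y z - 1"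
  "X z \<le> 0 \<Longrightarrow> Y z \<ge> 0 \<Longrightarrow> S z - L z = - g * X z + Y z - 1"
  "X z \<le> 0 \<Longrightarrow> Y z \<le> 0 \<Longrightarrow> S z - L z = - g * X z - d * Y z - 1"
  "X z \<ge> 0 \<Longrightarrow> Y z \<le> 0 \<Longrightarrow> S z - L z = X z - d * Y z - 1"
  unfolding S_def L_def by (simp_all add: field_simps)

lemma frontier_hull_sides:
  assumes "S z = L z"
  shows "z \<in> closed_segment A B \<or> z \<in> closed_segment B C \<or>
    z \<in> closed_segment C D \<or> z \<in> closed_segment D A"
proof -
  consider "X z \<ge> 0" "Y z \<ge> 0" | "X z \<le> 0" "Y z \<ge> 0" | "X z \<le> 0" "Y z \<le> 0" | "X z \<ge> 0" "Y z \<le> 0"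
    by linarith
  then show ?thesis
    by cases (use assms side_points[of z] S_minus_L[of z] in simp_all)
qed

text \<open>
  The witnesses are the points of the four sides with \<open>\<bar>y\<bar> = t \<bar>x\<bar>\<close>.
\<close>

lemma contact_points:
  assumes t: "t > 0"
  shows "\<exists>z\<in>conic t. z \<in> closed_segment A B"
    and "\<exists>z\<in>conic t. z \<in> closed_segment B C"
    and "\<exists>z\<in>conic t. z \<in> closed_segment C D"
    and "\<exists>z\<in>conic t. z \<in> closed_segment D A"
proof -
  have pos: "1 + t > 0" "g + t > 0" "g + t * d > 0" "1 + t * d > 0"
    using t g d by (simp_all add: add_pos_pos)
  show "\<exists>z\<in>conic t. z \<in> closed_segment A B"
  proof (rule bexI[of _ "pt (1 / (1 + t)) (t / (1 + t))"])
    let ?z = "pt (1 / (1 + t)) (t / (1 + t))"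
    have "X ?z + Y ?z = 1" using pos by (simp flip: add_divide_distrib)
    then show "?z \<in> closed_segment A B" "?z \<in> conic t"
      using side_points(1)[of ?z] S_minus_L(1)[of ?z] conic_frontier[OF t, of ?z] pos t by simp_all
  qed
  show "\<exists>z\<in>conic t. z \<in> closed_segment B C"
  proof (rule bexI[of _ "pt (- 1 / (g + t)) (t / (g + t))"])
    let ?z = "pt (- 1 / (g + t)) (t / (g + t))"
    have "- g * X ?z + Y ?z = 1" using pos by (simp flip: add_divide_distrib)
    then show "?z \<in> closed_segment B C" "?z \<in> conic t"
      using side_points(2)[of ?z] S_minus_L(2)[of ?z] conic_frontier[OF t, of ?z] pos t by simp_all
  qed
  show "\<exists>z\<in>conic t. z \<in> closed_segment C D"
  proof (rule bexI[of _ "pt (- 1 / (g + t * d)) (- t / (g + t * d))"])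
    let ?z = "pt (- 1 / (g + t * d)) (- t / (g + t * d))"
    have "- g * X ?z - d * Y ?z = 1" using pos by (simp add: mult.commute flip: add_divide_distrib)
    then show "?z \<in> closed_segment C D" "?z \<in> conic t"
      using side_points(3)[of ?z] S_minus_L(3)[of ?z] conic_frontier[OF t, of ?z] pos t by simp_all
  qed
  show "\<exists>z\<in>conic t. z \<in> closed_segment D A"
  proof (rule bexI[of _ "pt (1 / (1 + t * d)) (- t / (1 + t * d))"])
    let ?z = "pt (1 / (1 + t * d)) (- t / (1 + t * d))"
    have "X ?z - d * Y ?z = 1" using pos by (simp add: mult.commute flip: add_divide_distrib)
    then show "?z \<in> closed_segment D A" "?z \<in> conic t"
      using side_points(4)[of ?z] S_minus_L(4)[of ?z] conic_frontier[OF t, of ?z] pos t by simp_all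
  qed
qed

lemma inscribed_conic:
  assumes t: "t > 0"
  shows "inscribed (conic t) A B C D"
  using ellipse_conic[OF t] conic_subset_hull[OF t] contact_points[OF t]
    tangent_to_side_at_of_hull[OF ellipse_conic[OF t] conic_subset_hull[OF t]]
  unfolding inscribed_def tangent_to_side_def by blast

text \<open>
  The four supporting lines force the dual conic of an inscribed ellipse into the pencil through the
  corners of the rectangle, and centre and quadratic form determine the ellipse.
\<close>

lemma inscribed_imp_conic:
  assumes "inscribed E A B C D"
  shows "\<exists>t>0. E = conic t"
proof -
  have E: "ellipse E" "E \<subseteq> convex hull {A, B, C, D}"
    and sides: "\<exists>z\<in>E. z \<in> closed_segment A B" "\<exists>z\<in>E. z \<in> closed_segment B C"
      "\<exists>z\<in>E. z \<in> closed_segment C D" "\<exists>z\<in>E. z \<in> closed_segment D A"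
    using assms unfolding inscribed_def tangent_to_side_def tangent_to_side_at_def by blast+
  obtain c p q where pq: "det2 p q \<noteq> 0" and Eq: "E = circle_image c p q"
    using ellipse_circle_image[OF E(1)] .
  have le: "normal u v \<bullet> z \<le> normal u v \<bullet> P + 1" if "z \<in> E" "u \<in> {1, -g}" "v \<in> {1, -d}" for z u v
    using that E(2) unfolding hull_halfplanes by blast
  have seg: "normal u v \<bullet> z = normal u v \<bullet> P + 1"
    if z: "z \<in> closed_segment M N" and MN: "u * X M + v * Y M = 1" "u * X N + v * Y N = 1" for z M N u v
  proof -
    obtain a where a: "z = (1 - a) *\<^sub>R M + a *\<^sub>R N"
      using z unfolding in_segment by blast
    have "normal u v \<bullet> z = (1 - a) * (normal u v \<bullet> M) + a * (normal u v \<bullet> N)"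
      by (simp add: a inner_add_right)
    then show ?thesis
      using MN by (simp add: normal_inner[of u v M] normal_inner[of u v N] add.assoc left_diff_distrib)
  qed
  have touch: "\<exists>z\<in>E. normal u v \<bullet> z = normal u v \<bullet> P + 1" if "u \<in> {1, -g}" "v \<in> {1, -d}" for u v
  proof -
    have "\<exists>z\<in>E. normal 1 1 \<bullet> z = normal 1 1 \<bullet> P + 1"
      using sides(1) seg[of _ A B 1 1] by auto
    moreover have "\<exists>z\<in>E. normal (-g) 1 \<bullet> z = normal (-g) 1 \<bullet> P + 1"
      using sides(2) seg[of _ B C "-g" 1] g by auto
    moreover have "\<exists>z\<in>E. normal (-g) (-d) \<bullet> z = normal (-g) (-d) \<bullet> P + 1"
      using sides(3) seg[of _ C D "-g" "-d"] g d by auto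
    moreover have "\<exists>z\<in>E. normal 1 (-d) \<bullet> z = normal 1 (-d) \<bullet> P + 1"
      using sides(4) seg[of _ D A 1 "-d"] d by auto
    ultimately show ?thesis using that by blast
  qed
  have support: "(1 - (u * X c + v * Y c))\<^sup>2 =
        (u * (\<xi> \<bullet> p) + v * (\<eta> \<bullet> p))\<^sup>2 + (u * (\<xi> \<bullet> q) + v * (\<eta> \<bullet> q))\<^sup>2 \<and> u * X c + v * Y c < 1"
    if uv: "u \<in> {1, -g}" "v \<in> {1, -d}" for u v
  proof -
    obtain s r where sr: "s\<^sup>2 + r\<^sup>2 = 1" "normal u v \<bullet> (c + s *\<^sub>R p + r *\<^sub>R q) = normal u v \<bullet> P + 1"
      using touch[OF uv] unfolding Eq circle_image_def by blast
    have "normal u v \<noteq> 0" using uv g by (intro normal_nonzero) auto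
    note sup = circle_image_support[OF pq this le[OF _ uv, unfolded Eq] sr]
    show ?thesis
      using sup(1,2) unfolding normal_inner[of u v c] by (simp add: normal_def inner_add_left algebra_simps)
  qed
  have det: "(\<xi> \<bullet> p) * (\<eta> \<bullet> q) - (\<xi> \<bullet> q) * (\<eta> \<bullet> p) = det2 \<xi> \<eta> * det2 p q"
    unfolding det2_def inner_vec_def sum_2 inner_real_def by (simp only: algebra_simps)
  then have det0: "(\<xi> \<bullet> p) * (\<eta> \<bullet> q) - (\<xi> \<bullet> q) * (\<eta> \<bullet> p) \<noteq> 0"
    using pq det_frame by simp
  obtain l m where lm: "l > 0" "m > 0" "l * g + m * d = 1"
    and c: "X c = - (l * (1 - g) / 2)" "Y c = - (m * (1 - d) / 2)"
    and V: "(\<xi> \<bullet> p)\<^sup>2 + (\<xi> \<bullet> q)\<^sup>2 = (X c)\<^sup>2 + l" and W: "(\<eta> \<bullet> p)\<^sup>2 + (\<eta> \<bullet> q)\<^sup>2 = (Y c)\<^sup>2 + m"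
    and Z: "(\<xi> \<bullet> p) * (\<eta> \<bullet> p) + (\<xi> \<bullet> q) * (\<eta> \<bullet> q) = X c * Y c"
    by (rule dual_conic_through_rectangle[OF g d det0, of "X c" "Y c"]) (use support in blast)+
  let ?t = "(1 + d) * m / ((1 + g) * l)"
  have "z \<in> E \<longleftrightarrow> z \<in> conic ?t" for z
  proof -
    obtain s r where "z - c = s *\<^sub>R p + r *\<^sub>R q" using det2_expand[OF pq] .
    then have z: "z = c + s *\<^sub>R p + r *\<^sub>R q" by (simp add: algebra_simps)
    have x: "X z - X c = s * (\<xi> \<bullet> p) + r * (\<xi> \<bullet> q)" and y: "Y z - Y c = s * (\<eta> \<bullet> p) + r * (\<eta> \<bullet> q)"
      by (simp_all add: X_def Y_def z inner_add_right inner_diff_right)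
    let ?\<Delta> = "((\<xi> \<bullet> p) * (\<eta> \<bullet> q) - (\<xi> \<bullet> q) * (\<eta> \<bullet> p))\<^sup>2"
    have "z \<in> conic ?t \<longleftrightarrow>
      ((Y c)\<^sup>2 + m) * (X z - X c)\<^sup>2 - 2 * (X c * Y c) * (X z - X c) * (Y z - Y c)
        + ((X c)\<^sup>2 + l) * (Y z - Y c)\<^sup>2 = ((X c)\<^sup>2 + l) * ((Y c)\<^sup>2 + m) - (X c * Y c)\<^sup>2"
      unfolding conic_def using conic_eq_dual[OF lm(1,2) g d lm(3) c] by simp
    also have "((X c)\<^sup>2 + l) * ((Y c)\<^sup>2 + m) - (X c * Y c)\<^sup>2 = ?\<Delta>"
      unfolding V[symmetric] W[symmetric] Z[symmetric] by (simp add: power2_eq_square algebra_simps)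
    also have "((Y c)\<^sup>2 + m) * (X z - X c)\<^sup>2 - 2 * (X c * Y c) * (X z - X c) * (Y z - Y c)
        + ((X c)\<^sup>2 + l) * (Y z - Y c)\<^sup>2 = ?\<Delta> * (s\<^sup>2 + r\<^sup>2)"
      unfolding x y V[symmetric] W[symmetric] Z[symmetric] by (simp add: power2_eq_square algebra_simps)
    also have "?\<Delta> * (s\<^sup>2 + r\<^sup>2) = ?\<Delta> \<longleftrightarrow> s\<^sup>2 + r\<^sup>2 = 1"
      using det0 by simp
    finally show ?thesis
      unfolding Eq using circle_image_iff[OF pq] z by simp
  qed
  then have "E = conic ?t" by blast
  moreover have "?t > 0" using lm g d by simp
  ultimately show ?thesis by blast
qed

section \<open>Inscribed ellipses through a given point\<close>

text \<open>
  The contact point of \<open>conic t\<close> with the side \<open>A B\<close> satisfies \<open>y = t x\<close>, so it lies on no other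
  member of the family.
\<close>

lemma inj_on_conic: "inj_on conic {0<..}"
proof (rule inj_onI, simp)
  fix t t' :: real assume t: "0 < t" "0 < t'" and eq: "conic t = conic t'"
  define z where "z = pt (1 / (1 + t)) (t / (1 + t))"
  have X: "X z > 0" and Y: "Y z = t * X z" using t by (simp_all add: z_def)
  have "X z + Y z = 1" using t by (simp add: z_def flip: add_divide_distrib)
  then have SL: "S z = L z" using S_minus_L(1)[of z] t X Y by simp
  then have "z \<in> conic t" using conic_frontier[OF t(1) SL] t X Y by (simp add: abs_mult)
  then have "t' * \<bar>X z\<bar> = \<bar>Y z\<bar>"
    using conic_frontier[OF t(2) SL] eq by simp
  then show "t = t'" using t X Y by (simp add: abs_mult)
qed

lemma inscribed_through:
  "{E. inscribed E A B C D \<and> z \<in> E} = conic ` {t. t > 0 \<and> z \<in> conic t}"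
  using inscribed_conic inscribed_imp_conic by blast

lemma unique_inscribed:
  assumes "\<exists>!t. t > 0 \<and> z \<in> conic t"
  shows "\<exists>!E. inscribed E A B C D \<and> z \<in> E"
  using assms inscribed_conic inscribed_imp_conic by metis

lemma conic_pencil:
  assumes "t > 0"
  shows "z \<in> conic t \<longleftrightarrow> t * (X z)\<^sup>2 + (Y z)\<^sup>2 / t =
    2 * (\<bar>X z\<bar> * \<bar>Y z\<bar>) + 4 * ((L z)\<^sup>2 - (S z)\<^sup>2) / ((1 + g) * (1 + d))"
  using conic_eq_pencil[OF g d assms] unfolding conic_def L_def S_def by blast

lemma S_nonneg: "S z \<ge> 0"
  using g d by (simp add: S_def)

lemma pencil_const_pos:
  assumes "S z < L z"
  shows "4 * ((L z)\<^sup>2 - (S z)\<^sup>2) / ((1 + g) * (1 + d)) > 0"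
  using power_strict_mono[OF assms S_nonneg, of 2] g d by simp

lemma two_inscribed:
  assumes "S z < L z" "X z \<noteq> 0" "Y z \<noteq> 0"
  shows "card {E. inscribed E A B C D \<and> z \<in> E} = 2"
proof -
  have "card {t. t > 0 \<and> z \<in> conic t} = card {t. t > 0 \<and> t * (X z)\<^sup>2 + (Y z)\<^sup>2 / t =
      2 * (\<bar>X z\<bar> * \<bar>Y z\<bar>) + 4 * ((L z)\<^sup>2 - (S z)\<^sup>2) / ((1 + g) * (1 + d))}"
    by (intro arg_cong[of _ _ card] Collect_cong conj_cong refl conic_pencil)
  also have "\<dots> = 2"
    using pencil_const_pos[OF assms(1)] by (intro two_roots assms(2,3)) linarith
  finally have "card {t. t > 0 \<and> z \<in> conic t} = 2" .
  moreover have "inj_on conic {t. t > 0 \<and> z \<in> conic t}"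
    using inj_on_conic by (rule inj_on_subset) auto
  ultimately show ?thesis
    unfolding inscribed_through by (simp add: card_image)
qed

lemma one_inscribed_diagonal:
  assumes "S z < L z" "X z = 0 \<or> Y z = 0" "z \<noteq> P"
  shows "\<exists>!E. inscribed E A B C D \<and> z \<in> E"
proof (rule unique_inscribed)
  have "X z \<noteq> 0 \<or> Y z \<noteq> 0" using assms(3) eq_iff_coordinates[of z P] by auto
  note ex = one_root[OF this assms(2) pencil_const_pos[OF assms(1)]]
  show "\<exists>!t. t > 0 \<and> z \<in> conic t"
  proof -
    have "\<bar>X z\<bar> * \<bar>Y z\<bar> = 0" using assms(2) by auto
    then have "t > 0 \<and> z \<in> conic t \<longleftrightarrow> t > 0 \<and> t * (X z)\<^sup>2 + (Y z)\<^sup>2 / t =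
        4 * ((L z)\<^sup>2 - (S z)\<^sup>2) / ((1 + g) * (1 + d))" for t
      by (simp only: conic_pencil mult_zero_right add_0_left cong: conj_cong)
    then show ?thesis using ex by (simp only:)
  qed
qed

lemma one_inscribed_frontier:
  assumes "S z = L z" "X z \<noteq> 0" "Y z \<noteq> 0"
  shows "\<exists>!E. inscribed E A B C D \<and> z \<in> E"
proof (rule unique_inscribed, rule ex1I[of _ "\<bar>Y z\<bar> / \<bar>X z\<bar>"])
  show "\<bar>Y z\<bar> / \<bar>X z\<bar> > 0 \<and> z \<in> conic (\<bar>Y z\<bar> / \<bar>X z\<bar>)"
    using conic_frontier[OF _ assms(1), of "\<bar>Y z\<bar> / \<bar>X z\<bar>"] assms(2,3) by simp
  show "t = \<bar>Y z\<bar> / \<bar>X z\<bar>" if "t > 0 \<and> z \<in> conic t" for t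
  proof -
    have "t * \<bar>X z\<bar> = \<bar>Y z\<bar>" using that conic_frontier[OF _ assms(1)] by blast
    then show ?thesis using assms(2) by (simp add: eq_divide_eq)
  qed
qed

lemma diagonal_iff:
  assumes "S z \<le> L z"
  shows "z \<in> closed_segment A C \<longleftrightarrow> Y z = 0" and "z \<in> closed_segment B D \<longleftrightarrow> X z = 0"
proof -
  have comb: "X ((1 - u) *\<^sub>R M + u *\<^sub>R N) = (1 - u) * X M + u * X N"
    "Y ((1 - u) *\<^sub>R M + u *\<^sub>R N) = (1 - u) * Y M + u * Y N" for u M N
    by (simp_all add: X_def Y_def inner_add_right inner_diff_right algebra_simps)
  have range: "- g * X z \<le> 1" "X z \<le> 1" if "Y z = 0"
    using that assms unfolding hull_iff[symmetric] hull_halfplanes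
    by (simp_all add: normal_inner[of _ _ z])
  show "z \<in> closed_segment A C \<longleftrightarrow> Y z = 0"
  proof
    assume "Y z = 0"
    (* The solution of (1 - u) - u / g = X z, the coordinate along this diagonal. *)
    define u where "u = (1 - X z) / (1 + 1 / g)"
    have K: "1 + 1 / g > 0" using g by (simp add: add_pos_pos)
    then have "u * (1 + 1 / g) = 1 - X z" by (simp add: u_def)
    then have u: "X z = (1 - u) * 1 + u * (- (1 / g))" by (simp only: algebra_simps)
    have "- (1 / g) \<le> X z" using range(1)[OF \<open>Y z = 0\<close>] g by (simp add: field_simps)
    then have "0 \<le> u" "u \<le> 1"
      using range(2)[OF \<open>Y z = 0\<close>] K by (simp_all add: u_def divide_le_eq)
    moreover have "z = (1 - u) *\<^sub>R A + u *\<^sub>R C"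
      unfolding eq_iff_coordinates comb using \<open>Y z = 0\<close> u by simp
    ultimately show "z \<in> closed_segment A C" unfolding in_segment by blast
  qed (auto simp: in_segment comb)
  have range: "- d * Y z \<le> 1" "Y z \<le> 1" if "X z = 0"
    using that assms unfolding hull_iff[symmetric] hull_halfplanes
    by (simp_all add: normal_inner[of _ _ z])
  show "z \<in> closed_segment B D \<longleftrightarrow> X z = 0"
  proof
    assume "X z = 0"
    (* The solution of (1 - u) - u / d = Y z, the coordinate along this diagonal. *)
    define u where "u = (1 - Y z) / (1 + 1 / d)"
    have K: "1 + 1 / d > 0" using d by (simp add: add_pos_pos)
    then have "u * (1 + 1 / d) = 1 - Y z" by (simp add: u_def)
    then have u: "Y z = (1 - u) * 1 + u * (- (1 / d))" by (simp only: algebra_simps)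
    have "- (1 / d) \<le> Y z" using range(1)[OF \<open>X z = 0\<close>] d by (simp add: field_simps)
    then have "0 \<le> u" "u \<le> 1"
      using range(2)[OF \<open>X z = 0\<close>] K by (simp_all add: u_def divide_le_eq)
    moreover have "z = (1 - u) *\<^sub>R B + u *\<^sub>R D"
      unfolding eq_iff_coordinates comb using \<open>X z = 0\<close> u by simp
    ultimately show "z \<in> closed_segment B D" unfolding in_segment by blast
  qed (auto simp: in_segment comb)
qed

lemma frontier_on_diagonal_imp_vertex:
  assumes "S z = L z" "X z = 0 \<or> Y z = 0"
  shows "z \<in> {A, B, C, D}"
proof -
  consider "X z \<ge> 0" "Y z \<ge> 0" | "X z \<le> 0" "Y z \<ge> 0" | "X z \<le> 0" "Y z \<le> 0" | "X z \<ge> 0" "Y z \<le> 0"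
    by linarith
  then show ?thesis
    unfolding insert_iff empty_iff eq_iff_coordinates[of z]
    by cases (use assms g d S_minus_L[of z] in \<open>auto simp: field_simps\<close>)
qed

lemma none_through_P: "P \<notin> conic t"
  by (simp add: conic_def conic_eq_def)

end

section \<open>Convex quadrilaterals and their diagonals\<close>

lemma det2_eq_0_imp_parallel:
  assumes "det2 p q = 0" "q \<noteq> 0"
  obtains \<kappa> where "p = \<kappa> *\<^sub>R q"
proof (rule orthogonal_2_parallel)
  let ?n = "vector [- (q$2), q$1] :: real^2"
  show "?n \<noteq> 0" using assms(2) by (simp add: vec_eq_iff forall_2) blast
  show "?n \<bullet> p = 0" "?n \<bullet> q = 0"
    using assms(1) by (simp_all add: inner_vec_def sum_2 det2_def mult.commute)
qed (use assms that in auto)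

lemma dual_basis_exists:
  assumes "det2 a b \<noteq> 0"
  obtains \<xi> \<eta> :: "real^2" where "\<xi> \<bullet> a = 1" "\<xi> \<bullet> b = 0" "\<eta> \<bullet> a = 0" "\<eta> \<bullet> b = 1"
proof
  let ?\<xi> = "(1 / det2 a b) *\<^sub>R vector [b$2, - (b$1)] :: real^2"
  let ?\<eta> = "(1 / det2 a b) *\<^sub>R vector [- (a$2), a$1] :: real^2"
  have "(vector [b$2, - (b$1)] :: real^2) \<bullet> a = det2 a b" "(vector [- (a$2), a$1] :: real^2) \<bullet> b = det2 a b"
    "(vector [b$2, - (b$1)] :: real^2) \<bullet> b = 0" "(vector [- (a$2), a$1] :: real^2) \<bullet> a = 0"
    by (simp_all add: inner_vec_def sum_2 det2_def)
  then show "?\<xi> \<bullet> a = 1" "?\<xi> \<bullet> b = 0" "?\<eta> \<bullet> a = 0" "?\<eta> \<bullet> b = 1"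
    using assms by simp_all
qed

text \<open>
  Otherwise the face property would put \<open>R\<close> on the segment from \<open>M\<close> to \<open>N\<close>, while \<open>M\<close> lies between
  \<open>N\<close> and \<open>R\<close>.
\<close>

lemma face_endpoint_not_between:
  fixes M N R :: "'a::euclidean_space"
  assumes "closed_segment M N face_of H" "N \<in> H" "R \<in> H" "M \<noteq> N" "M \<noteq> R"
  shows "M \<notin> closed_segment N R"
proof
  assume M: "M \<in> closed_segment N R"
  then have "M \<in> open_segment N R" using assms by (simp add: open_segment_def)
  then have "R \<in> closed_segment M N"
    using face_ofD[OF assms(1)] assms by (metis ends_in_segment(1))
  with M show False
    using between_antisym[of R N M] assms(5) by (simp add: between_mem_segment closed_segment_commute)
qed

text \<open>
  In a hull of dimension at most one, an edge is the whole hull. Two neighbouring sides would then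
  coincide, so that \<open>C\<close> lies between \<open>A\<close> and \<open>B\<close> and also \<open>A\<close> between \<open>B\<close> and \<open>C\<close>.
\<close>

lemma convex_quadrilateral_not_collinear:
  assumes "convex_quadrilateral A B C D"
  shows "\<not> collinear {A, B, C, D}"
proof
  let ?H = "convex hull {A, B, C, D}"
  assume "collinear {A, B, C, D}"
  then have dim: "aff_dim ?H \<le> 1" by (simp add: collinear_aff_dim aff_dim_convex_hull)
  have "F = ?H" if "F edge_of ?H" for F
    using that dim face_of_aff_dim_lt[OF convex_convex_hull, of F] unfolding edge_of_def by force
  then have "closed_segment A B = ?H" "closed_segment B C = ?H"
    using assms unfolding convex_quadrilateral_def by blast+
  then have "C \<in> closed_segment A B" "A \<in> closed_segment B C"
    by (auto intro: hull_inc)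
  then have "A = C"
    using between_antisym[of C B A] by (simp add: between_mem_segment closed_segment_commute)
  then show False using assms by (simp add: convex_quadrilateral_def)
qed

lemma open_segment_opposite:
  fixes M N P :: "'a::real_vector"
  assumes "P \<in> closed_segment M N" "P \<noteq> M" "P \<noteq> N"
  obtains k where "k > 0" "N = P - (1 / k) *\<^sub>R (M - P)"
proof -
  obtain u where u: "0 \<le> u" "u \<le> 1" and P: "P = (1 - u) *\<^sub>R M + u *\<^sub>R N"
    using assms(1) unfolding in_segment by blast
  have "u \<noteq> 0" "u \<noteq> 1" using P assms by auto
  then have u': "0 < u" "u < 1" using u by auto
  have "u *\<^sub>R (N - P) = - (1 - u) *\<^sub>R (M - P)"
    unfolding P by (simp add: algebra_simps)
  then have "(1 / u) *\<^sub>R u *\<^sub>R (N - P) = (1 / u) *\<^sub>R (- (1 - u) *\<^sub>R (M - P))" by simp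
  then have "N - P = ((u - 1) / u) *\<^sub>R (M - P)" using u' by simp
  then have "N = P + ((u - 1) / u) *\<^sub>R (M - P)" by (metis add.commute diff_add_cancel)
  moreover have "(u - 1) / u = - (1 / (u / (1 - u)))" using u' by (simp add: field_simps)
  ultimately have "N = P - (1 / (u / (1 - u))) *\<^sub>R (M - P)"
    by (simp only: scaleR_minus_left add_uminus_conv_diff)
  then show ?thesis using u' by (intro that[of "u / (1 - u)"]) auto
qed

text \<open>
  No vertex lies on the diagonal through its neighbours, hence \<open>P\<close> is interior to both diagonals, and
  \<open>C - P\<close>, \<open>D - P\<close> are negative multiples of \<open>A - P\<close>, \<open>B - P\<close>. If these two vectors were
  parallel, all four vertices would be collinear.
\<close>

lemma convex_quadrilateral_diagonal_frame:
  assumes Q: "convex_quadrilateral A B C D"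
    and P: "P \<in> closed_segment A C" "P \<in> closed_segment B D"
  obtains \<xi> \<eta> g d where "diagonal_frame A B C D P \<xi> \<eta> g d"
proof -
  let ?H = "convex hull {A, B, C, D}"
  have faces: "closed_segment A B face_of ?H" "closed_segment B C face_of ?H"
      "closed_segment C D face_of ?H" "closed_segment D A face_of ?H"
    and dist: "distinct [A, B, C, D]"
    using Q unfolding convex_quadrilateral_def edge_of_def by auto
  have H: "A \<in> ?H" "B \<in> ?H" "C \<in> ?H" "D \<in> ?H" by (auto intro: hull_inc)
  have "A \<notin> closed_segment B D" "B \<notin> closed_segment C A" "C \<notin> closed_segment D B" "D \<notin> closed_segment A C"
    using face_endpoint_not_between[OF faces(1) H(2,4)] face_endpoint_not_between[OF faces(2) H(3,1)]
      face_endpoint_not_between[OF faces(3) H(4,2)] face_endpoint_not_between[OF faces(4) H(1,3)] dist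
    by auto
  then have ne: "P \<noteq> A" "P \<noteq> B" "P \<noteq> C" "P \<noteq> D"
    using P by (auto simp: closed_segment_commute)
  obtain g where g: "g > 0" "C = P - (1 / g) *\<^sub>R (A - P)"
    using open_segment_opposite[OF P(1)] ne by metis
  obtain d where d: "d > 0" "D = P - (1 / d) *\<^sub>R (B - P)"
    using open_segment_opposite[OF P(2)] ne by metis
  have "det2 (A - P) (B - P) \<noteq> 0"
  proof
    assume "det2 (A - P) (B - P) = 0"
    then obtain \<kappa> where A: "A - P = \<kappa> *\<^sub>R (B - P)"
      using det2_eq_0_imp_parallel ne by (metis eq_iff_diff_eq_0)
    have line: "\<exists>k. V = P + k *\<^sub>R (B - P)" if "V \<in> {A, B, C, D}" for V
    proof -
      have "A = P + \<kappa> *\<^sub>R (B - P)" using A by (simp add: algebra_simps)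
      moreover have "B = P + 1 *\<^sub>R (B - P)" by simp
      moreover have "C = P + (- (\<kappa> / g)) *\<^sub>R (B - P)" using g(2) by (simp add: A)
      moreover have "D = P + (- (1 / d)) *\<^sub>R (B - P)" using d(2) by simp
      ultimately show ?thesis using that by blast
    qed
    have "collinear {A, B, C, D}"
      unfolding collinear_def
    proof (intro exI[of _ "B - P"] ballI)
      fix V W assume "V \<in> {A, B, C, D}" "W \<in> {A, B, C, D}"
      then obtain k k' where "V = P + k *\<^sub>R (B - P)" "W = P + k' *\<^sub>R (B - P)"
        using line by metis
      then have "V - W = (k - k') *\<^sub>R (B - P)" by (simp add: scaleR_left_diff_distrib)
      then show "\<exists>c. V - W = c *\<^sub>R (B - P)" by blast
    qed
    then show False using convex_quadrilateral_not_collinear[OF Q] by blast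
  qed
  then obtain \<xi> \<eta> where "\<xi> \<bullet> (A - P) = 1" "\<xi> \<bullet> (B - P) = 0" "\<eta> \<bullet> (A - P) = 0" "\<eta> \<bullet> (B - P) = 1"
    using dual_basis_exists by blast
  then show ?thesis
    using g d by (intro that[of \<xi> \<eta> g d]) (unfold_locales, auto)
qed

theorem theorem1p1:
  fixes A B C D P P0 :: "real^2" and Q D1 D2 :: "(real^2) set"
  assumes "convex_quadrilateral A B C D"
    and "Q = convex hull {A, B, C, D}"
    and "D1 = closed_segment A C" and "D2 = closed_segment B D"
    and "D1 \<inter> D2 = {P}"
    and "P0 \<in> Q"
  shows "(P0 \<in> interior Q \<and> P0 \<notin> D1 \<union> D2 \<longrightarrow>
            card {E. inscribed E A B C D \<and> P0 \<in> E} = 2) \<and>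
         (P0 \<in> interior Q \<and> P0 \<in> D1 \<union> D2 \<and> P0 \<noteq> P \<longrightarrow>
            (\<exists>!E. inscribed E A B C D \<and> P0 \<in> E)) \<and>
         \<not> (\<exists>E. inscribed E A B C D \<and> P \<in> E) \<and>
         (P0 \<in> frontier Q \<and> P0 \<notin> {A, B, C, D} \<longrightarrow>
            (\<exists>!E. inscribed E A B C D \<and> P0 \<in> E) \<and>
            (\<forall>E. inscribed E A B C D \<and> P0 \<in> E \<longrightarrow>
               tangent_to_side_at E A B P0 \<or> tangent_to_side_at E B C P0 \<or>
               tangent_to_side_at E C D P0 \<or> tangent_to_side_at E D A P0))"
proof -
  have "P \<in> closed_segment A C" "P \<in> closed_segment B D" using assms(3-5) by auto
  then obtain \<xi> \<eta> g d where "diagonal_frame A B C D P \<xi> \<eta> g d"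
    using convex_quadrilateral_diagonal_frame[OF assms(1)] by blast
  then interpret diagonal_frame A B C D P \<xi> \<eta> g d .
  have SL: "S P0 \<le> L P0" using assms(2,6) hull_iff by blast
  have diag: "P0 \<in> D1 \<union> D2 \<longleftrightarrow> X P0 = 0 \<or> Y P0 = 0"
    unfolding assms(3,4) Un_iff diagonal_iff[OF SL] by blast
  show ?thesis
    unfolding assms(2) interior_hull_iff frontier_hull_iff diag
  proof (intro conjI impI allI)
    assume "S P0 < L P0 \<and> \<not> (X P0 = 0 \<or> Y P0 = 0)"
    then show "card {E. inscribed E A B C D \<and> P0 \<in> E} = 2"
      using two_inscribed by blast
  next
    assume "S P0 < L P0 \<and> (X P0 = 0 \<or> Y P0 = 0) \<and> P0 \<noteq> P"
    then show "\<exists>!E. inscribed E A B C D \<and> P0 \<in> E"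
      using one_inscribed_diagonal by blast
  next
    show "\<not> (\<exists>E. inscribed E A B C D \<and> P \<in> E)"
      using inscribed_imp_conic none_through_P by blast
  next
    assume *: "S P0 = L P0 \<and> P0 \<notin> {A, B, C, D}"
    then show "\<exists>!E. inscribed E A B C D \<and> P0 \<in> E"
      using one_inscribed_frontier frontier_on_diagonal_imp_vertex by blast
    fix E assume "inscribed E A B C D \<and> P0 \<in> E"
    then have E: "ellipse E" "E \<subseteq> convex hull {A, B, C, D}" and "P0 \<in> E"
      unfolding inscribed_def by blast+
    from tangent_to_side_at_of_hull[OF this]
    show "tangent_to_side_at E A B P0 \<or> tangent_to_side_at E B C P0 \<or>
        tangent_to_side_at E C D P0 \<or> tangent_to_side_at E D A P0"
      using frontier_hull_sides * by blast
  qed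
qed

end
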